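(* Let $\pi = 1 \oplus \rho$ where $\rho$ starts with a descent (i.e. $\rho(1) > \rho(2)$), suppose $\pi$ has no increasing bond, and suppose $\pi$ satisfies condition $(\ddagger)$: there is at least one entry of $\pi$ lying to the right of the entry of value $2$ whose value is less than the value of the leftmost entry of $\rho$ (i.e. less than $\pi(2)$). Then the class $\operatorname{Av}(\pi)$ is not deflatable.
   Context: A permutation $\alpha$ is contained in $\beta$ if $\beta$ has a subsequence in the same relative order as $\alpha$; a class is a set of permutations closed under taking contained permutations; $\operatorname{Av}(\pi)$ is the class of permutations not containing $\pi$. $1\oplus\rho$ is the permutation $1\,(\rho(1)+1)\,(\rho(2)+1)\cdots$, i.e. a new minimum entry placed before a copy of $\rho$. A bond of a permutation is a pair of entries in adjacent positions whose values differ by $1$; it is increasing if they form the pattern $12$. An interval of a permutation is a set of entries whose positions and values each form a set of consecutive integers, the whole permutation not counting as an interval; a permutation is simple if all its intervals are single entries (so $1$, $12$, $21$ are simple). A class $\mathcal{C}$ is deflatable if there is a proper subclass $\mathcal{D}\subsetneq\mathcal{C}$ with $\mathcal{C}\subseteq\langle\mathcal{D}\rangle$, where the substitution closure $\langle\mathcal{D}\rangle$ is the largest class whose simple permutations are exactly those of $\mathcal{D}$; equivalently, $\mathcal{C}$ is not deflatable if and only if every permutation in $\mathcal{C}$ is contained in some simple permutation belonging to $\mathcal{C}$. *)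

theory Defs
  imports "HOL-Library.Sublist" "HOL-Combinatorics.Multiset_Permutations"
begin

text \<open>
  Permutations are lists in one-line notation with values \<open>1, \<dots>, n\<close>.  List positions are
  0-based, so the paper's \<open>\<pi>(i)\<close> is \<open>\<pi> ! (i - 1)\<close>.  The empty permutation is allowed.
\<close>

definition is_perm :: "nat list \<Rightarrow> bool" where
  "is_perm p \<longleftrightarrow> p \<in> permutations_of_set {1..length p}"

definition order_iso :: "nat list \<Rightarrow> nat list \<Rightarrow> bool" where
  "order_iso s t \<longleftrightarrow> length s = length t \<and>
     (\<forall>i < length s. \<forall>j < length s. s ! i < s ! j \<longleftrightarrow> t ! i < t ! j)"

definition contained_in :: "nat list \<Rightarrow> nat list \<Rightarrow> bool" where
  "contained_in a b \<longleftrightarrow> (\<exists>s. subseq s b \<and> order_iso s a)"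

definition perm_class :: "nat list set \<Rightarrow> bool" where
  "perm_class C \<longleftrightarrow> (\<forall>p \<in> C. is_perm p) \<and>
     (\<forall>b \<in> C. \<forall>a. is_perm a \<and> contained_in a b \<longrightarrow> a \<in> C)"

definition Av :: "nat list \<Rightarrow> nat list set" where
  "Av p = {q. is_perm q \<and> \<not> contained_in p q}"

definition one_oplus :: "nat list \<Rightarrow> nat list" where
  "one_oplus r = 1 # map Suc r"

definition has_increasing_bond :: "nat list \<Rightarrow> bool" where
  "has_increasing_bond p \<longleftrightarrow> (\<exists>i. Suc i < length p \<and> p ! Suc i = p ! i + 1)"

definition consecutive :: "nat set \<Rightarrow> bool" where
  "consecutive S \<longleftrightarrow> (\<exists>a b. S = {a..b})"

text \<open>
  An interval, a set of entries, is represented by its set of positions; as usual it is nonempty.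
\<close>

definition perm_interval :: "nat list \<Rightarrow> nat set \<Rightarrow> bool" where
  "perm_interval p I \<longleftrightarrow> I \<noteq> {} \<and> I \<subset> {..<length p} \<and>
     consecutive I \<and> consecutive ((!) p ` I)"

text \<open>The empty permutation is not regarded as simple.\<close>

definition simple_perm :: "nat list \<Rightarrow> bool" where
  "simple_perm p \<longleftrightarrow> is_perm p \<and> p \<noteq> [] \<and> (\<forall>I. perm_interval p I \<longrightarrow> is_singleton I)"

definition simples :: "nat list set \<Rightarrow> nat list set" where
  "simples C = {p \<in> C. simple_perm p}"

text \<open>
  The largest class whose simple permutations are exactly those of \<open>D\<close>; the union is
  itself such a class, by \<open>subst_closure_largest\<close> below.
\<close>

definition subst_closure :: "nat list set \<Rightarrow> nat list set" where
  "subst_closure D = \<Union>{E. perm_class E \<and> simples E = simples D}"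

lemma subst_closure_largest:
  assumes "perm_class D"
  shows "perm_class (subst_closure D)"
    and "simples (subst_closure D) = simples D"
    and "\<And>E. perm_class E \<Longrightarrow> simples E = simples D \<Longrightarrow> E \<subseteq> subst_closure D"
proof -
  show "perm_class (subst_closure D)"
    unfolding subst_closure_def perm_class_def by blast
  show "simples (subst_closure D) = simples D"
    using assms unfolding subst_closure_def simples_def by blast
  show "\<And>E. perm_class E \<Longrightarrow> simples E = simples D \<Longrightarrow> E \<subseteq> subst_closure D"
    unfolding subst_closure_def by blast
qed

definition deflatable :: "nat list set \<Rightarrow> bool" where
  "deflatable C \<longleftrightarrow> (\<exists>D. perm_class D \<and> D \<subset> C \<and> C \<subseteq> subst_closure D)"

text \<open>Condition \<open>(\<ddagger>)\<close>: the leftmost entry of \<open>\<rho>\<close> in \<open>\<pi> = 1 \<oplus> \<rho>\<close> is \<open>\<pi> ! 1\<close>.\<close>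

definition ddagger :: "nat list \<Rightarrow> bool" where
  "ddagger p \<longleftrightarrow> (\<exists>i j. i < j \<and> j < length p \<and> p ! i = 2 \<and> p ! j < p ! 1)"

end

theory Submission
  imports Defs
begin

text \<open>
  Permutations are drawn as finite point sets in general position, so that points can be added
  at real coordinates.  Every permutation avoiding \<open>\<pi>\<close> is extended to a simple one avoiding \<open>\<pi>\<close>.
  First, points are added until it is neither a direct sum nor a skew sum.  Next, let \<open>K\<close> be a maximal
  nontrivial interval containing a left-to-right minimum, \<open>u\<close> its lowest entry and \<open>w\<close> the lowest entry
  above and to the right of \<open>K\<close>.  A point \<open>z\<close> with value just above \<open>u\<close> and position next to \<open>w\<close> cuts
  \<open>K\<close>.  A copy of \<open>\<pi>\<close> using \<open>z\<close> either has \<open>z\<close> in the role of \<open>2\<close> with its \<open>1\<close> at \<open>u\<close>, where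
  \<open>(\<ddagger>)\<close> keeps the rest of the copy outside \<open>K\<close>, or lies wholly to the right of \<open>K\<close>; in both
  cases \<open>z\<close> can be replaced by \<open>w\<close>, or \<open>z\<close> and \<open>w\<close> form an increasing bond of \<open>\<pi>\<close>.
  Once no interval contains a left-to-right minimum, each remaining one is cut by a new left-to-right
  minimum placed just below the last one before it; this creates no copy of \<open>\<pi>\<close>, because
  the new point sees above and to its right only what the old minimum sees.
\<close>

section \<open>Permutations as point sets in general position\<close>

type_synonym point = "real \<times> real"

definition generic :: "point set \<Rightarrow> bool" where
  "generic P \<longleftrightarrow> finite P \<and> inj_on fst P \<and> inj_on snd P"

text \<open>Only the values of \<open>f\<close> at indices below \<open>length p\<close> matter.
  Positions are required to increase in one direction only; the converse is
  \<open>occurrence_less_cancel\<close>.\<close>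

definition occurrence :: "nat list \<Rightarrow> point set \<Rightarrow> (nat \<Rightarrow> point) \<Rightarrow> bool" where
  "occurrence p P f \<longleftrightarrow> (\<forall>i<length p. f i \<in> P) \<and>
     (\<forall>i j. i < j \<longrightarrow> j < length p \<longrightarrow> fst (f i) < fst (f j)) \<and>
     (\<forall>i<length p. \<forall>j<length p. snd (f i) < snd (f j) \<longleftrightarrow> p ! i < p ! j)"

definition avoids :: "nat list \<Rightarrow> point set \<Rightarrow> bool" where
  "avoids p P \<longleftrightarrow> (\<forall>f. \<not> occurrence p P f)"

definition convex_in :: "point set \<Rightarrow> point set \<Rightarrow> bool" where
  "convex_in P H \<longleftrightarrow> H \<subseteq> P \<and> (\<forall>a\<in>H. \<forall>b\<in>H. \<forall>c\<in>P.
     (fst a < fst c \<and> fst c < fst b) \<or> (snd a < snd c \<and> snd c < snd b) \<longrightarrow> c \<in> H)"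

definition intervals :: "point set \<Rightarrow> point set set" where
  "intervals P = {H. convex_in P H \<and> 2 \<le> card H \<and> H \<noteq> P}"

definition lr_min :: "point set \<Rightarrow> point \<Rightarrow> bool" where
  "lr_min P m \<longleftrightarrow> m \<in> P \<and> (\<forall>q\<in>P. fst q < fst m \<longrightarrow> snd m < snd q)"

definition lr_intervals :: "point set \<Rightarrow> point set set" where
  "lr_intervals P = {H \<in> intervals P. \<exists>m\<in>H. lr_min P m}"

definition sum_cut :: "point set \<Rightarrow> point set \<Rightarrow> point set \<Rightarrow> bool" where
  "sum_cut P A B \<longleftrightarrow> A \<noteq> {} \<and> B \<noteq> {} \<and> A \<union> B = P \<and>
     (\<forall>a\<in>A. \<forall>b\<in>B. fst a < fst b \<and> snd a < snd b)"

definition skew_cut :: "point set \<Rightarrow> point set \<Rightarrow> point set \<Rightarrow> bool" where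
  "skew_cut P A B \<longleftrightarrow> A \<noteq> {} \<and> B \<noteq> {} \<and> A \<union> B = P \<and>
     (\<forall>a\<in>A. \<forall>b\<in>B. fst a < fst b \<and> snd b < snd a)"

definition sum_indec :: "point set \<Rightarrow> bool" where
  "sum_indec P \<longleftrightarrow> (\<forall>A B. \<not> sum_cut P A B)"

definition skew_indec :: "point set \<Rightarrow> bool" where
  "skew_indec P \<longleftrightarrow> (\<forall>A B. \<not> skew_cut P A B)"

text \<open>A point inserted immediately beside an existing one takes its coordinate from here or
  from the mirror image \<open>gap_right\<close>: \<open>a\<close> is new and no element of
  \<open>S\<close> separates it from \<open>x\<close>.\<close>

lemma gap_left:
  assumes "finite (S :: real set)"
  obtains a where "a < x" "\<And>s. s \<in> S \<Longrightarrow> s < x \<Longrightarrow> s < a"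
proof -
  have "\<exists>a<x. \<forall>s\<in>S. s < x \<longrightarrow> s < a" using assms
  proof (induction S)
    case empty
    then show ?case by (auto intro: exI[of _ "x - 1"])
  next
    case (insert y S)
    then obtain a where a: "a < x" "\<forall>s\<in>S. s < x \<longrightarrow> s < a" by blast
    show ?case
    proof (cases "y < x")
      case True
      then obtain b where "max a y < b" "b < x" using a dense[of "max a y" x] by auto
      with a show ?thesis by (intro exI[of _ b]) force
    next
      case False
      with a show ?thesis by (intro exI[of _ a]) auto
    qed
  qed
  then show ?thesis using that by blast
qed

lemma gap_right:
  assumes "finite (S :: real set)"
  obtains a where "x < a" "\<And>s. s \<in> S \<Longrightarrow> x < s \<Longrightarrow> a < s"
proof -
  obtain a where a: "a < - x" "\<And>s. s \<in> uminus ` S \<Longrightarrow> s < - x \<Longrightarrow> s < a"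
    using gap_left[of "uminus ` S" "- x"] assms by blast
  have "- a < s" if "s \<in> S" "x < s" for s
    using a(2)[of "- s"] that by auto
  then show ?thesis using that[of "- a"] a(1) by auto
qed

lemma ex_least:
  assumes "finite S" "S \<noteq> {}"
  obtains x where "x \<in> S" "\<And>y. y \<in> S \<Longrightarrow> (f x :: real) \<le> f y"
proof -
  have "Min (f ` S) \<in> f ` S" using assms by (intro Min_in) auto
  then obtain x where "x \<in> S" "f x = Min (f ` S)" by auto
  with assms that show ?thesis by (metis Min_le finite_imageI imageI)
qed

lemma ex_other:
  assumes "2 \<le> card K" obtains k where "k \<in> K" "k \<noteq> u"
proof -
  have "\<not> K \<subseteq> {u}" using card_mono[of "{u}" K] assms by auto
  then show ?thesis using that by blast
qed

lemma generic_insert: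
  assumes "generic P" "fst z \<notin> fst ` P" "snd z \<notin> snd ` P"
  shows "generic (insert z P)"
  using assms unfolding generic_def inj_on_insert by blast

lemma genericD:
  assumes "generic P"
  shows "finite P" "\<And>a b. a \<in> P \<Longrightarrow> b \<in> P \<Longrightarrow> fst a = fst b \<Longrightarrow> a = b"
    "\<And>a b. a \<in> P \<Longrightarrow> b \<in> P \<Longrightarrow> snd a = snd b \<Longrightarrow> a = b"
  using assms unfolding generic_def inj_on_def by blast+

section \<open>Convex subsets and decompositions\<close>

lemma convex_inD:
  assumes "convex_in P H"
  shows "H \<subseteq> P"
    "\<And>a b c. a \<in> H \<Longrightarrow> b \<in> H \<Longrightarrow> c \<in> P \<Longrightarrow> fst a < fst c \<Longrightarrow> fst c < fst b \<Longrightarrow> c \<in> H"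
    "\<And>a b c. a \<in> H \<Longrightarrow> b \<in> H \<Longrightarrow> c \<in> P \<Longrightarrow> snd a < snd c \<Longrightarrow> snd c < snd b \<Longrightarrow> c \<in> H"
  using assms unfolding convex_in_def by blast+

text \<open>An outside point on different sides of two members would lie between them, and ties are
  excluded by general position. Hence an outside point sees \<open>H\<close> like a single
  point.\<close>

lemma convex_outside:
  assumes g: "generic P" and H: "convex_in P H" and q: "q \<in> P" "q \<notin> H" and k: "k \<in> H" "k' \<in> H"
  shows "fst q < fst k \<Longrightarrow> fst q < fst k'" "fst k < fst q \<Longrightarrow> fst k' < fst q"
    "snd q < snd k \<Longrightarrow> snd q < snd k'" "snd k < snd q \<Longrightarrow> snd k' < snd q"
proof -
  have "k' \<in> P" using convex_inD(1)[OF H] k by blast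
  then have ne: "fst q \<noteq> fst k'" "snd q \<noteq> snd k'"
    using genericD(2,3)[OF g q(1), of k'] q(2) k(2) by auto
  note c = convex_inD(2,3)[OF H k q(1)] convex_inD(2,3)[OF H k(2,1) q(1)]
  show "fst q < fst k \<Longrightarrow> fst q < fst k'" using c(3) q(2) ne(1) by (cases "fst k' < fst q") auto
  show "fst k < fst q \<Longrightarrow> fst k' < fst q" using c(1) q(2) ne(1) by (cases "fst k' < fst q") auto
  show "snd q < snd k \<Longrightarrow> snd q < snd k'" using c(4) q(2) ne(2) by (cases "snd k' < snd q") auto
  show "snd k < snd q \<Longrightarrow> snd k' < snd q" using c(2) q(2) ne(2) by (cases "snd k' < snd q") auto
qed

lemma convex_in_restrict:
  assumes "convex_in P' L" "P \<subseteq> P'"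
  shows "convex_in P (L \<inter> P)"
  using assms unfolding convex_in_def by blast

lemma convex_in_subset:
  assumes "convex_in P' L" "P \<subseteq> P'" "L \<subseteq> P"
  shows "convex_in P L"
  using assms unfolding convex_in_def by blast

lemma convex_in_Un:
  assumes g: "generic P" and H: "convex_in P H" and K: "convex_in P K" and "k \<in> H \<inter> K"
  shows "convex_in P (H \<union> K)"
proof -
  have kH: "k \<in> H" and kK: "k \<in> K" using assms by auto
  have kP: "k \<in> P" using kH convex_inD(1)[OF H] by blast
  have "c \<in> H \<union> K" if a: "a \<in> H \<union> K" and b: "b \<in> H \<union> K" and c: "c \<in> P"
    and o: "(fst a < fst c \<and> fst c < fst b) \<or> (snd a < snd c \<and> snd c < snd b)" for a b c
  proof (rule ccontr)
    assume "c \<notin> H \<union> K"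
    then have cH: "c \<notin> H" and cK: "c \<notin> K" by auto
    \<comment> \<open>\<open>c\<close> sees both \<open>H\<close> and \<open>K\<close> as it sees
      their common point \<open>k\<close>, so it cannot lie between two points of the union.\<close>
    have 1: "(fst x < fst c \<longleftrightarrow> fst k < fst c) \<and> (fst c < fst x \<longleftrightarrow> fst c < fst k) \<and>
        (snd x < snd c \<longleftrightarrow> snd k < snd c) \<and> (snd c < snd x \<longleftrightarrow> snd c < snd k)"
      if "x \<in> H \<union> K" for x
    proof (cases "x \<in> H")
      case True
      from convex_outside[OF g H c cH True kH] convex_outside[OF g H c cH kH True]
      show ?thesis by blast
    next
      case False
      with that have "x \<in> K" by simp
      from convex_outside[OF g K c cK this kK] convex_outside[OF g K c cK kK this]
      show ?thesis by blast
    qed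
    from 1[OF a] 1[OF b] o show False by auto
  qed
  then show ?thesis using H K unfolding convex_in_def by blast
qed

text \<open>The complement \<open>A\<close> of \<open>H\<close> lies in \<open>K\<close>. Each point
  of \<open>A\<close> sees all of \<open>H\<close> alike, and a point \<open>x\<close> of
  \<open>H\<close> outside \<open>K\<close> sees all of \<open>A\<close> alike; so all comparisons
  between \<open>A\<close> and \<open>H\<close> agree and give one of four cuts.\<close>

lemma covering_pair_decomposes:
  assumes g: "generic P" and H: "convex_in P H" and K: "convex_in P K" and un: "H \<union> K = P"
    and ne: "H \<noteq> P" "K \<noteq> P" "H \<noteq> {}"
  shows "\<not> (sum_indec P \<and> skew_indec P)"
proof -
  define A where "A = P - H"
  have AK: "A \<subseteq> K" using un unfolding A_def by blast
  have A: "A \<noteq> {}" "A \<union> H = P" "H \<union> A = P" using un ne unfolding A_def by auto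
  obtain x where x: "x \<in> H" "x \<notin> K" "x \<in> P" using ne un by blast
  obtain a0 where a0: "a0 \<in> A" using A by blast
  have aP: "a \<in> P" "a \<notin> H" "a \<in> K" if "a \<in> A" for a using that AK unfolding A_def by auto
  have dis: "fst a < fst x \<or> fst x < fst a" "snd a < snd x \<or> snd x < snd a" if "a \<in> A" for a
    using genericD(2,3)[OF g, of a x] aP[OF that] x by (metis linorder_neqE_linordered_idom)+
  have f: "fst a < fst h \<longleftrightarrow> fst a0 < fst x" "fst h < fst a \<longleftrightarrow> fst x < fst a0"
    "snd a < snd h \<longleftrightarrow> snd a0 < snd x" "snd h < snd a \<longleftrightarrow> snd x < snd a0" if "a \<in> A" "h \<in> H" for a h
  proof -
    note a = aP[OF that(1)] and a0' = aP[OF a0]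
    note 1 = convex_outside[OF g H a(1,2) that(2) x(1)] convex_outside[OF g H a(1,2) x(1) that(2)]
    note 2 = convex_outside[OF g K x(3) x(2) a(3) a0'(3)] convex_outside[OF g K x(3) x(2) a0'(3) a(3)]
    from 1 2 show "fst a < fst h \<longleftrightarrow> fst a0 < fst x" "fst h < fst a \<longleftrightarrow> fst x < fst a0"
      "snd a < snd h \<longleftrightarrow> snd a0 < snd x" "snd h < snd a \<longleftrightarrow> snd x < snd a0"
      by blast+
  qed
  have "sum_cut P A H \<or> sum_cut P H A \<or> skew_cut P A H \<or> skew_cut P H A"
    using dis[OF a0] A ne(3) f unfolding sum_cut_def skew_cut_def by auto
  then show ?thesis unfolding sum_indec_def skew_indec_def by blast
qed

section \<open>Insertion preserves indecomposability\<close>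

text \<open>A point lying between two points of \<open>P\<close> in some coordinate cannot form one
  side of a cut alone. Both sides therefore meet \<open>P\<close>, and the cut restricts to
  \<open>P\<close>.\<close>

lemma sum_indec_insert:
  assumes s: "sum_indec P" and p: "p \<in> P" "p' \<in> P"
    and i: "(fst p < fst z \<and> fst z < fst p') \<or> (snd p < snd z \<and> snd z < snd p')"
  shows "sum_indec (insert z P)"
proof -
  have False if c: "sum_cut (insert z P) A B" for A B
  proof -
    have ab: "fst a < fst b" "snd a < snd b" if "a \<in> A" "b \<in> B" for a b
      using c that unfolding sum_cut_def by auto
    have ne: "A \<noteq> {}" "B \<noteq> {}" "A \<union> B = insert z P" using c unfolding sum_cut_def by auto
    have pp: "p \<in> A \<or> p \<in> B" "p' \<in> A \<or> p' \<in> B" using ne p by auto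
    have "A \<inter> P \<noteq> {}"
    proof
      assume "A \<inter> P = {}"
      then have "z \<in> A" "p \<in> B" "p' \<in> B" using ne p pp by auto
      then show False using i ab[of z p] ab[of z p'] by auto
    qed
    moreover have "B \<inter> P \<noteq> {}"
    proof
      assume "B \<inter> P = {}"
      then have "z \<in> B" "p \<in> A" "p' \<in> A" using ne p pp by auto
      then show False using i ab[of p z] ab[of p' z] by auto
    qed
    ultimately have "sum_cut P (A \<inter> P) (B \<inter> P)" using ab ne unfolding sum_cut_def by blast
    then show False using s unfolding sum_indec_def by blast
  qed
  then show ?thesis unfolding sum_indec_def by blast
qed

text \<open>The argument of \<open>sum_indec_insert\<close> with heights reversed.\<close>

lemma skew_indec_insert:
  assumes s: "skew_indec P" and p: "p \<in> P" "p' \<in> P"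
    and i: "(fst p < fst z \<and> fst z < fst p') \<or> (snd p < snd z \<and> snd z < snd p')"
  shows "skew_indec (insert z P)"
proof -
  have False if c: "skew_cut (insert z P) A B" for A B
  proof -
    have ab: "fst a < fst b" "snd b < snd a" if "a \<in> A" "b \<in> B" for a b
      using c that unfolding skew_cut_def by auto
    have ne: "A \<noteq> {}" "B \<noteq> {}" "A \<union> B = insert z P" using c unfolding skew_cut_def by auto
    have pp: "p \<in> A \<or> p \<in> B" "p' \<in> A \<or> p' \<in> B" using ne p by auto
    have "A \<inter> P \<noteq> {}"
    proof
      assume "A \<inter> P = {}"
      then have "z \<in> A" "p \<in> B" "p' \<in> B" using ne p pp by auto
      then show False using i ab[of z p] ab[of z p'] by auto
    qed
    moreover have "B \<inter> P \<noteq> {}"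
    proof
      assume "B \<inter> P = {}"
      then have "z \<in> B" "p \<in> A" "p' \<in> A" using ne p pp by auto
      then show False using i ab[of p z] ab[of p' z] by auto
    qed
    ultimately have "skew_cut P (A \<inter> P) (B \<inter> P)" using ab ne unfolding skew_cut_def by blast
    then show False using s unfolding skew_indec_def by blast
  qed
  then show ?thesis unfolding skew_indec_def by blast
qed

section \<open>Copies of a pattern in a point set\<close>

lemma occurrenceD:
  assumes "occurrence p P f"
  shows "\<And>i. i < length p \<Longrightarrow> f i \<in> P"
    "\<And>i j. i < j \<Longrightarrow> j < length p \<Longrightarrow> fst (f i) < fst (f j)"
    "\<And>i j. i < length p \<Longrightarrow> j < length p \<Longrightarrow> snd (f i) < snd (f j) \<longleftrightarrow> p ! i < p ! j"
  using assms unfolding occurrence_def by blast+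

lemma occurrence_mono:
  "occurrence p P f \<Longrightarrow> P \<subseteq> Q \<Longrightarrow> occurrence p Q f"
  unfolding occurrence_def by blast

lemma occurrence_less_cancel:
  assumes f: "occurrence p P f" and "i < length p" "j < length p" and l: "fst (f i) < fst (f j)"
  shows "i < j"
proof (rule ccontr)
  assume "\<not> i < j"
  then consider "i = j" | "j < i" by linarith
  then show False using occurrenceD(2)[OF f, of j i] assms by cases auto
qed

lemma occurrence_inj:
  assumes f: "occurrence p P f" and "i < length p" "j < length p" "f i = f j"
  shows "i = j"
proof (rule ccontr)
  assume "i \<noteq> j"
  then consider "i < j" | "j < i" by linarith
  then show False
    using occurrenceD(2)[OF f, of j i] occurrenceD(2)[OF f, of i j] assms by cases auto
qed

text \<open>The avoidance proofs start here: a copy missing \<open>z\<close> would lie in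
  \<open>P\<close>, and injectivity of copies makes the index at \<open>z\<close> unique.\<close>

lemma occurrence_insert_uses:
  assumes "avoids p P" "occurrence p (insert z P) f"
  obtains j where "j < length p" "f j = z"
    "\<And>i. i < length p \<Longrightarrow> i \<noteq> j \<Longrightarrow> f i \<in> P \<and> f i \<noteq> z"
proof -
  have "\<exists>j<length p. f j = z"
  proof (rule ccontr)
    assume "\<not> ?thesis"
    then have "occurrence p P f" using assms(2) unfolding occurrence_def by blast
    then show False using assms(1) unfolding avoids_def by blast
  qed
  then obtain j where j: "j < length p" "f j = z" by blast
  then have "f i \<in> P \<and> f i \<noteq> z" if "i < length p" "i \<noteq> j" for i
    using occurrence_inj[OF assms(2) that(1) j(1)] occurrenceD(1)[OF assms(2) that(1)] that by auto
  with j that show ?thesis by blast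
qed

text \<open>\<open>w\<close> can take over the role of \<open>z\<close> because the other entries
  lie on the same sides of both. Heights are compared by an equivalence, so ties must be excluded
  explicitly; for positions the copy itself excludes ties with \<open>z\<close>.\<close>

lemma occurrence_replace:
  assumes f: "occurrence p (insert z P) f" and j: "j < length p" "f j = z" and w: "w \<in> P"
    and P: "\<And>i. i < length p \<Longrightarrow> i \<noteq> j \<Longrightarrow> f i \<in> P"
    and x: "\<And>i. i < length p \<Longrightarrow> i \<noteq> j \<Longrightarrow>
      (fst (f i) < fst z \<longrightarrow> fst (f i) < fst w) \<and> (fst z < fst (f i) \<longrightarrow> fst w < fst (f i)) \<and>
      (snd (f i) < snd z \<and> snd (f i) < snd w \<or> snd z < snd (f i) \<and> snd w < snd (f i))"
  shows "\<exists>f. occurrence p P f"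
proof -
  have fo: "fst (f i) < fst (f k)" if "i < k" "k < length p" for i k
    using occurrenceD(2)[OF f that] .
  have so: "snd (f i) < snd (f k) \<longleftrightarrow> p ! i < p ! k" if "i < length p" "k < length p" for i k
    using occurrenceD(3)[OF f that] .
  have "occurrence p P (f(j := w))"
    unfolding occurrence_def
  proof (intro conjI allI impI)
    fix i assume "i < length p" then show "(f(j := w)) i \<in> P" using w P by auto
  next
    fix i k assume ik: "i < k" "k < length p"
    show "fst ((f(j := w)) i) < fst ((f(j := w)) k)"
      using x[of i] x[of k] fo[OF ik] ik j by auto
  next
    fix i k assume ik: "i < length p" "k < length p"
    show "snd ((f(j := w)) i) < snd ((f(j := w)) k) \<longleftrightarrow> p ! i < p ! k"
    proof -
      consider "i = j" "k = j" | "i = j" "k \<noteq> j" | "i \<noteq> j" "k = j" | "i \<noteq> j" "k \<noteq> j" by blast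
      then show ?thesis
      proof cases
        case 2
        with x[of k] so[OF ik] ik j show ?thesis by auto
      next
        case 3
        with x[of i] so[OF ik] ik j show ?thesis by auto
      qed (use so[OF ik] in auto)
    qed
  qed
  then show ?thesis by blast
qed

section \<open>Extensions avoiding the pattern\<close>

locale pattern =
  fixes p :: "nat list"
  assumes perm: "is_perm p" and p0: "p ! 0 = 1"
    and no_bond: "\<not> has_increasing_bond p" and dag: "ddagger p"
begin

section \<open>Entries of the pattern\<close>

lemma value_index:
  assumes "1 \<le> v" "v \<le> length p"
  obtains i where "i < length p" "p ! i = v"
  using assms perm permutations_of_setD(1)[of p] unfolding is_perm_def
  by (metis atLeastAtMost_iff in_set_conv_nth)

lemma index_value:
  assumes "i < length p" shows "1 \<le> p ! i" "p ! i \<le> length p"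
  using assms perm permutations_of_setD(1)[of p] unfolding is_perm_def
  by (metis atLeastAtMost_iff nth_mem)+

lemma index_inj: "i < length p \<Longrightarrow> j < length p \<Longrightarrow> p ! i = p ! j \<Longrightarrow> i = j"
  using perm permutations_of_setD(2)[of p] unfolding is_perm_def
  by (metis nth_eq_iff_index_eq)

text \<open>The entry that \<open>ddagger\<close> puts to the right of \<open>2\<close> is neither 1
  nor 2, so it is at least 3 and \<open>p ! 1\<close> is at least 4. Hence \<open>2\<close> is not
  at index 1, and the pattern has at least four entries.\<close>

lemma dag_indices:
  obtains i j where "1 < i" "i < j" "j < length p" "p ! i = 2" "p ! j < p ! 1" "4 \<le> length p"
proof -
  obtain i j where ij: "i < j" "j < length p" "p ! i = 2" "p ! j < p ! 1"
    using dag unfolding ddagger_def by blast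
  have pos: "0 < length p" "j \<noteq> 0" using ij by auto
  have i0: "i \<noteq> 0" using ij p0 by (metis numeral_eq_one_iff semiring_norm(85))
  have "p ! j \<noteq> p ! 0" "p ! j \<noteq> p ! i" using index_inj[OF ij(2) pos(1)] index_inj[of j i] ij pos(2) by auto
  then have 3: "3 \<le> p ! j" using index_value(1)[of j] ij p0 by auto
  then have "i \<noteq> 1" using ij by auto
  with i0 have "1 < i" by simp
  moreover have "4 \<le> length p" using index_value(2)[of 1] 3 ij by linarith
  ultimately show ?thesis using that ij by blast
qed

lemma length_ge: "4 \<le> length p"
  using dag_indices by blast

lemma length_pos: "0 < length p"
  using length_ge by linarith

lemma first_below:
  assumes "0 < i" "i < length p" shows "p ! 0 < p ! i"
  using index_inj[of i 0] index_value(1)[of i] p0 assms by fastforce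

lemma occurrence_first:
  assumes "occurrence p P f" "0 < i" "i < length p"
  shows "fst (f 0) < fst (f i)" "snd (f 0) < snd (f i)"
  using occurrenceD(2)[OF assms(1), of 0 i] occurrenceD(3)[OF assms(1) length_pos, of i] first_below[of i] assms
  by auto

text \<open>Since \<^term>\<open>p\<close> has no increasing bond, a copy cannot use both points of an inserted bond,
  and if it uses only one of them, then the other could take its place.\<close>
lemma bond_insert:
  assumes av: "avoids p P" and f: "occurrence p (insert z P) f"
    and j: "j < length p" "f j = z"
    and P: "\<And>i. i < length p \<Longrightarrow> i \<noteq> j \<Longrightarrow> f i \<in> P"
    and w: "w \<in> P" and g: "generic P" and zP: "fst z \<notin> fst ` P" "snd z \<notin> snd ` P"
    and zw: "fst z < fst w" "snd z < snd w"
    and adj: "\<And>q. q \<in> P \<Longrightarrow> fst q < fst w \<Longrightarrow> fst q < fst z"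
    and up: "\<And>i. i < length p \<Longrightarrow> i \<noteq> j \<Longrightarrow> snd z < snd (f i) \<Longrightarrow> snd w \<le> snd (f i)"
  shows False
proof (cases "\<exists>l<length p. f l = w")
  case False
  have "\<exists>f. occurrence p P f"
  proof (rule occurrence_replace[OF f j w P])
    fix i assume i: "i < length p" "i \<noteq> j"
    have fi: "f i \<in> P" "f i \<noteq> w" using P[OF i] False i by auto
    have ne: "fst (f i) \<noteq> fst w" "snd (f i) \<noteq> snd w" "snd (f i) \<noteq> snd z"
      using genericD(2,3)[OF g fi(1) w] fi zP by (auto simp: image_iff)
    show "(fst (f i) < fst z \<longrightarrow> fst (f i) < fst w) \<and> (fst z < fst (f i) \<longrightarrow> fst w < fst (f i)) \<and>
      (snd (f i) < snd z \<and> snd (f i) < snd w \<or> snd z < snd (f i) \<and> snd w < snd (f i))"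
      using ne zw adj[OF fi(1)] up[OF i] by linarith
  qed
  then show False using av unfolding avoids_def by blast
next
  case True
  then obtain l where l: "l < length p" "f l = w" by blast
  have jl: "j < l" using occurrence_less_cancel[OF f j(1) l(1)] j l zw by simp
  \<comment> \<open>No point of \<open>P\<close> lies horizontally between \<open>z\<close> and
    \<open>w\<close>, so no entry of the copy comes between them.\<close>
  have lj: "l = Suc j"
  proof (rule ccontr)
    assume "l \<noteq> Suc j"
    then have s: "Suc j < l" using jl by simp
    then have "fst (f (Suc j)) < fst w" "fst z < fst (f (Suc j))"
      using occurrenceD(2)[OF f, of "Suc j" l] occurrenceD(2)[OF f, of j "Suc j"] l j by auto
    moreover have "f (Suc j) \<in> P" using P[of "Suc j"] s l by simp
    ultimately show False using adj by fastforce
  qed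
  have pjl: "p ! j < p ! l" using occurrenceD(3)[OF f j(1) l(1)] j l zw by simp
  \<comment> \<open>With the bond excluded, the value following \<open>p ! j\<close> belongs to a
    third entry, whose point would lie above \<open>z\<close> and below \<open>w\<close>, against
    \<open>up\<close>.\<close>
  have "p ! l \<noteq> p ! j + 1" using no_bond l lj unfolding has_increasing_bond_def by blast
  then have v: "p ! j + 1 < p ! l" using pjl by simp
  moreover have "p ! l \<le> length p" using index_value l by blast
  ultimately obtain i where i: "i < length p" "p ! i = p ! j + 1"
    using value_index[of "p ! j + 1"] by auto
  have "snd z < snd (f i)" "snd (f i) < snd w"
    using occurrenceD(3)[OF f j(1) i(1)] occurrenceD(3)[OF f i(1) l(1)] i v j l by auto
  moreover have "i \<noteq> j" using i by auto
  ultimately show False using up[OF i(1)] by auto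
qed

section \<open>Insertions that create no copy\<close>

text \<open>As first entry of a copy, \<open>z\<close> would need points to its right; as a later
  entry, it would need the first entry below it.\<close>

lemma avoids_corner:
  assumes av: "avoids p P" and "\<And>q. q \<in> P \<Longrightarrow> fst q < fst z \<and> snd z < snd q"
  shows "avoids p (insert z P)"
  unfolding avoids_def
proof (intro allI notI)
  fix f assume f: "occurrence p (insert z P) f"
  obtain j where j: "j < length p" "f j = z"
    and P: "\<And>i. i < length p \<Longrightarrow> i \<noteq> j \<Longrightarrow> f i \<in> P \<and> f i \<noteq> z"
    using occurrence_insert_uses[OF av f] by metis
  show False
  proof (cases "j = 0")
    case True
    have "fst z < fst (f 1)" using occurrence_first(1)[OF f, of 1] length_ge True j by simp
    then show False using P[of 1] length_ge True assms(2)[of "f 1"] by fastforce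
  next
    case False
    then have "snd (f 0) < snd z" "f 0 \<in> P" using occurrence_first(2)[OF f, of j] P[of 0] length_pos j by auto
    then show False using assms(2) by fastforce
  qed
qed

text \<open>Only \<^term>\<open>z\<close> and \<^term>\<open>k\<close> lie above and to the right of \<^term>\<open>q\<close>.  A copy using \<^term>\<open>z\<close> would
  therefore have its first entry at \<^term>\<open>u\<close>, with \<^term>\<open>z\<close> both its entry \<open>2\<close> and its last entry,
  which \<open>(\<ddagger>)\<close> excludes.\<close>
lemma avoids_skew_link:
  assumes g: "generic P" and av: "avoids p P" and cut: "skew_cut P A B"
    and u: "u \<in> A" "\<And>a. a \<in> A \<Longrightarrow> snd u \<le> snd a"
    and k: "k \<in> B" "\<And>b. b \<in> B \<Longrightarrow> snd b \<le> snd k"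
    and x: "\<And>a. a \<in> A \<Longrightarrow> fst a < fst q" "fst q < fst z" "\<And>b. b \<in> B \<Longrightarrow> fst z < fst b"
    and y: "snd q < snd k" "\<And>b. b \<in> P \<Longrightarrow> snd b < snd k \<Longrightarrow> snd b < snd q"
      "snd u < snd z" "\<And>a. a \<in> P \<Longrightarrow> snd u < snd a \<Longrightarrow> snd z < snd a"
  shows "avoids p (insert z (insert q P))"
proof -
  have AB: "A \<union> B = P" "\<And>a b. a \<in> A \<Longrightarrow> b \<in> B \<Longrightarrow> snd b < snd a" using cut unfolding skew_cut_def by auto
  have qu: "snd q < snd u" using AB(2)[OF u(1) k(1)] y(1) by linarith
  have above_q: "b = k" if "b \<in> B" "snd q < snd b" for b
    using y(2)[of b] k(2)[OF that(1)] that AB genericD(3)[OF g, of b k] k(1) by fastforce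
  \<comment> \<open>The two points are added one at a time. As first entry, \<open>q\<close> would
    have only \<open>k\<close> above and to its right; as a later entry, it would need a point of
    \<open>A\<close> below it, while all of \<open>A\<close> is above \<open>q\<close>.\<close>
  have avq: "avoids p (insert q P)"
    unfolding avoids_def
  proof (intro allI notI)
    fix f assume f: "occurrence p (insert q P) f"
    obtain j where j: "j < length p" "f j = q"
      and P: "\<And>i. i < length p \<Longrightarrow> i \<noteq> j \<Longrightarrow> f i \<in> P \<and> f i \<noteq> q"
      using occurrence_insert_uses[OF av f] by metis
    show False
    proof (cases "j = 0")
      case True
      have "f i = k" if "0 < i" "i < length p" for i
      proof -
        have "fst q < fst (f i)" "snd q < snd (f i)" using occurrence_first[OF f that] True j by auto
        moreover from this have "f i \<in> B" using P[of i] x(1)[of "f i"] that True AB(1) by auto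
        ultimately show ?thesis using above_q by blast
      qed
      from this[of 1] this[of 2] have "f 1 = f 2" using length_ge by simp
      then show False using occurrence_inj[OF f, of 1 2] length_ge by auto
    next
      case False
      then have *: "fst (f 0) < fst q" "snd (f 0) < snd q" "f 0 \<in> P"
        using occurrence_first[OF f, of j] P[of 0] length_pos j by auto
      then have "f 0 \<in> A" using AB(1) x(2) x(3)[of "f 0"] by auto
      then show False using u(2)[of "f 0"] * qu by linarith
    qed
  qed
  show ?thesis
    unfolding avoids_def
  proof (intro allI notI)
    fix f assume f: "occurrence p (insert z (insert q P)) f"
    obtain j where j: "j < length p" "f j = z"
      and P: "\<And>i. i < length p \<Longrightarrow> i \<noteq> j \<Longrightarrow> f i \<in> insert q P \<and> f i \<noteq> z"
      using occurrence_insert_uses[OF avq f] by metis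
    have right: "b \<in> B" if "b \<in> insert q P" "fst z < fst b" for b
      using that x(1)[of b] x(2) AB(1) by auto
    obtain i' j' where dag': "1 < i'" "i' < j'" "j' < length p" "p ! i' = 2" "p ! j' < p ! 1"
      using dag_indices by metis
    show False
    proof (cases "j = 0")
      case True
      have "fst z < fst (f 1)" "snd z < snd (f 1)" using occurrence_first[OF f, of 1] length_ge True j by auto
      moreover from this have "f 1 \<in> B" using right P[of 1] True length_ge by auto
      ultimately show False using AB(2)[OF u(1), of "f 1"] y(3) by linarith
    next
      case False
      then have f0: "fst (f 0) < fst z" "snd (f 0) < snd z" "f 0 \<in> insert q P"
        using occurrence_first[OF f, of j] P[of 0] length_pos j by auto
      then have "f 0 = q \<or> f 0 \<in> A" using x(3)[of "f 0"] AB(1) by auto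
      then show False
      proof
        assume q: "f 0 = q"
        \<comment> \<open>Entries 1, 2 and 3 would have to share the two points \<open>z\<close> and
          \<open>k\<close>.\<close>
        have "f i = z \<or> f i = k" if "0 < i" "i < length p" for i
        proof (cases "i = j")
          case False
          have *: "fst q < fst (f i)" "snd q < snd (f i)" using occurrence_first[OF f that] q by auto
          with P[OF that(2) False] have "f i \<in> P" by auto
          with * have "f i \<in> B" using x(1)[of "f i"] AB(1) by auto
          with * show ?thesis using above_q by blast
        qed (use j in simp)
        from this[of 1] this[of 2] this[of 3] have "f 1 = f 2 \<or> f 2 = f 3 \<or> f 1 = f 3"
          using length_ge by auto
        then show False using occurrence_inj[OF f, of 1 2] occurrence_inj[OF f, of 2 3]
            occurrence_inj[OF f, of 1 3] length_ge by auto
      next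
        assume A: "f 0 \<in> A"
        then have "f 0 = u" using u f0 y(4)[of "f 0"] AB(1) genericD(3)[OF g, of "f 0" u] by fastforce
        have above_u: "snd u < snd (f i)" if "0 < i" "i < length p" for i
          using occurrence_first(2)[OF f that] \<open>f 0 = u\<close> by simp
        \<comment> \<open>Otherwise the entry \<open>2\<close> would be a point of \<open>P\<close>
          strictly between the heights of \<open>u\<close> and \<open>z\<close>, where there is
          none.\<close>
        have "j = i'"
        proof (rule ccontr)
          assume ne: "j \<noteq> i'"
          have i': "i' < length p" "0 < i'" using dag' by auto
          have "p ! j \<noteq> 1" "p ! j \<noteq> 2"
            using index_inj[OF j(1) length_pos] index_inj[OF j(1) i'(1)] p0 dag' False ne by auto
          then have "snd (f i') < snd z"
            using occurrenceD(3)[OF f i'(1) j(1)] j index_value(1)[OF j(1)] dag' by auto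
          moreover have "f i' \<in> P" using P[of i'] ne i' above_u[OF i'(2,1)] qu by auto
          ultimately show False using y(4) above_u[OF i'(2,1)] by fastforce
        qed
        \<comment> \<open>\<open>ddagger\<close> supplies an entry to the right of \<open>2\<close>,
          here to the right of \<open>z\<close>. It lies in \<open>B\<close>, hence below
          \<open>u\<close>, although \<open>u\<close> is the lowest entry of the copy.\<close>
        then have "fst z < fst (f j')" "f j' \<in> insert q P" "snd u < snd (f j')"
          using occurrenceD(2)[OF f dag'(2,3)] j P[of j'] dag' above_u[of j'] by auto
        then show False using right AB(2)[OF u(1)] by fastforce
      qed
    qed
  qed
qed

text \<open>If \<open>z\<close> is the first entry of a copy, the others are above and to the right
  of \<open>z\<close>, hence of \<open>m\<close>, and \<open>m\<close> replaces \<open>z\<close>. If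
  \<open>z\<close> comes later, the first entry is to the left of and below \<open>z\<close>, but
  every point on the left is at least as high as \<open>m\<close>.\<close>

lemma avoids_lr_min:
  assumes g: "generic P" and av: "avoids p P" and m: "m \<in> P" "fst m < fst z" "snd z < snd m"
    and left: "\<And>q. q \<in> P \<Longrightarrow> fst q < fst z \<Longrightarrow> snd m \<le> snd q"
    and gap: "\<And>q. q \<in> P \<Longrightarrow> snd q < snd m \<Longrightarrow> snd q < snd z"
  shows "avoids p (insert z P)"
  unfolding avoids_def
proof (intro allI notI)
  fix f assume f: "occurrence p (insert z P) f"
  obtain j where j: "j < length p" "f j = z"
    and P: "\<And>i. i < length p \<Longrightarrow> i \<noteq> j \<Longrightarrow> f i \<in> P \<and> f i \<noteq> z"
    using occurrence_insert_uses[OF av f] by metis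
  show False
  proof (cases "j = 0")
    case True
    have "\<exists>f. occurrence p P f"
    proof (rule occurrence_replace[OF f j m(1)])
      fix i assume i: "i < length p" "i \<noteq> j"
      then show "f i \<in> P" using P by blast
      have *: "fst z < fst (f i)" "snd z < snd (f i)" using occurrence_first[OF f _ i(1)] i j True by auto
      have "\<not> snd (f i) < snd m" using gap[of "f i"] P[OF i] * by auto
      moreover have "snd (f i) \<noteq> snd m" using genericD(3)[OF g, of "f i" m] P[OF i] m * by auto
      ultimately show "(fst (f i) < fst z \<longrightarrow> fst (f i) < fst m) \<and> (fst z < fst (f i) \<longrightarrow> fst m < fst (f i)) \<and>
        (snd (f i) < snd z \<and> snd (f i) < snd m \<or> snd z < snd (f i) \<and> snd m < snd (f i))"
        using * m by linarith
    qed
    then show False using av unfolding avoids_def by blast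
  next
    case False
    then have "fst (f 0) < fst z" "snd (f 0) < snd z" "f 0 \<in> P"
      using occurrence_first[OF f, of j] P[of 0] length_pos j by auto
    then show False using left[of "f 0"] m by linarith
  qed
qed

text \<open>A copy through \<open>z\<close> has three possible forms. With \<open>z\<close> first,
  \<open>u\<close> replaces it. If it starts in \<open>K\<close>, it starts at \<open>u\<close> and
  its entries other than \<open>u\<close> and \<open>z\<close> lie outside \<open>K\<close>. If it
  starts in \<open>P\<close> outside \<open>K\<close>, it lies wholly to the right of
  \<open>K\<close>. The last two forms fall to \<open>bond_insert\<close> when \<open>z\<close> is
  just left of \<open>w\<close>; when \<open>z\<close> is just right of \<open>w\<close>, the order
  of positions is contradictory.\<close>

lemma avoids_interval_breaker:
  assumes g: "generic P" and av: "avoids p P" and K: "convex_in P K"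
    and m: "m \<in> K" "lr_min P m" and u: "u \<in> K" "\<And>k. k \<in> K \<Longrightarrow> snd u \<le> snd k"
    and w: "w \<in> P" "fst u < fst w" "snd u < snd w" "w \<notin> K"
    and w_min: "\<And>q. q \<in> P - K \<Longrightarrow> fst u < fst q \<Longrightarrow> snd u < snd q \<Longrightarrow> snd w \<le> snd q"
    and zP: "fst z \<notin> fst ` P" "snd z \<notin> snd ` P"
    and Kz: "\<And>k. k \<in> K \<Longrightarrow> fst k < fst z"
    and uz: "snd u < snd z" "\<And>q. q \<in> P \<Longrightarrow> snd u < snd q \<Longrightarrow> snd z < snd q"
    and zw: "(fst z < fst w \<and> (\<forall>q\<in>P. fst q < fst w \<longrightarrow> fst q < fst z)) \<or>
      (fst w < fst z \<and> (\<forall>q\<in>P. fst w < fst q \<longrightarrow> fst z < fst q) \<and>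
        (\<forall>q\<in>P-K. fst u < fst q \<longrightarrow> fst w \<le> fst q))"
  shows "avoids p (insert z P)"
  unfolding avoids_def
proof (intro allI notI)
  fix f assume f: "occurrence p (insert z P) f"
  obtain j where j: "j < length p" "f j = z"
    and P: "\<And>i. i < length p \<Longrightarrow> i \<noteq> j \<Longrightarrow> f i \<in> P \<and> f i \<noteq> z"
    using occurrence_insert_uses[OF av f] by metis
  obtain i' j' where dag': "1 < i'" "i' < j'" "j' < length p" "p ! i' = 2" "p ! j' < p ! 1"
    using dag_indices by metis
  have uP: "u \<in> P" and KP: "K \<subseteq> P" using u convex_inD(1)[OF K] by auto
  have zw2: "snd z < snd w" using uz w by blast
  show False
  proof (cases "j = 0")
    case True
    have "\<exists>f. occurrence p P f"
    proof (rule occurrence_replace[OF f j uP])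
      fix i assume i: "i < length p" "i \<noteq> j"
      then show "f i \<in> P" using P by blast
      have "fst z < fst (f i)" "snd z < snd (f i)" using occurrence_first[OF f _ i(1)] i j True by auto
      then show "(fst (f i) < fst z \<longrightarrow> fst (f i) < fst u) \<and> (fst z < fst (f i) \<longrightarrow> fst u < fst (f i)) \<and>
        (snd (f i) < snd z \<and> snd (f i) < snd u \<or> snd z < snd (f i) \<and> snd u < snd (f i))"
        using uz Kz[OF u(1)] by linarith
    qed
    then show False using av unfolding avoids_def by blast
  next
    case False
    then have f0: "fst (f 0) < fst z" "snd (f 0) < snd z" "f 0 \<in> P"
      using occurrence_first[OF f, of j] P[of 0] length_pos j by auto
    have f0u: "snd (f 0) \<le> snd u" using uz(2)[OF f0(3)] f0 by linarith
    show False
    proof (cases "f 0 \<in> K")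
      case True
      then have eq: "f 0 = u" using u(2)[of "f 0"] f0u f0 genericD(3)[OF g, of "f 0" u] uP by simp
      have beyond_u: "fst u < fst (f i)" "snd u < snd (f i)" if "0 < i" "i < length p" for i
        using occurrence_first[OF f that] eq by auto
      \<comment> \<open>No point of \<open>P\<close> has height between \<open>u\<close> and
        \<open>z\<close>, so in a copy starting at \<open>u\<close> the entry \<open>2\<close> can
        only be \<open>z\<close>.\<close>
      have "j = i'"
      proof (rule ccontr)
        assume ne: "j \<noteq> i'"
        have i': "i' < length p" "0 < i'" using dag' by auto
        have "p ! j \<noteq> 1" "p ! j \<noteq> 2"
          using index_inj[OF j(1) length_pos] index_inj[OF j(1) i'(1)] p0 dag' False ne by auto
        then have "snd (f i') < snd z"
          using occurrenceD(3)[OF f i'(1) j(1)] j index_value(1)[OF j(1)] dag' by auto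
        then show False using uz(2)[of "f i'"] beyond_u[OF i'(2,1)] P[of i'] ne i' by auto
      qed
      have y: "fst z < fst (f j')" "f j' \<in> P" "snd u < snd (f j')"
        using occurrenceD(2)[OF f dag'(2,3)] j P[of j'] dag' beyond_u[of j'] \<open>j = i'\<close> by auto
      then have yK: "f j' \<notin> K" using Kz by fastforce
      have f1: "f 1 \<in> P" "fst u < fst (f 1)" "snd (f j') < snd (f 1)" "fst (f 1) < fst z"
        using P[of 1] \<open>j = i'\<close> dag' beyond_u[of 1] occurrenceD(3)[OF f dag'(3), of 1]
          occurrenceD(2)[OF f, of 1 j] j by auto
      have yu: "snd k < snd (f j')" if "k \<in> K" for k
        using convex_outside(4)[OF g K y(2) yK u(1) that] y(3) by blast
      have f1K: "f 1 \<notin> K" using yu f1(3) by fastforce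
      \<comment> \<open>Entry 1 is higher than \<open>f j'\<close>, which is above all of
        \<open>K\<close>. Being outside \<open>K\<close> and right of \<open>u\<close>, entry 1 is
        right of all of \<open>K\<close>, and so are the later entries.\<close>
      have J: "f i \<in> P - K" if i: "0 < i" "i < length p" "i \<noteq> j" for i
      proof (cases "i = 1")
        case True
        then show ?thesis using f1 f1K by simp
      next
        case False
        have "fst (f 1) < fst (f i)" using occurrenceD(2)[OF f, of 1 i] i False by simp
        moreover have "fst k < fst (f 1)" if "k \<in> K" for k
          using convex_outside(2)[OF g K f1(1) f1K u(1) that] f1(2) by blast
        ultimately show ?thesis using P[of i] i by fastforce
      qed
      have w_le: "snd w \<le> snd (f i)" if "0 < i" "i < length p" "i \<noteq> j" for i
        using w_min[OF J[OF that]] beyond_u[OF that(1,2)] by blast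
      from zw show False
      proof
        assume a: "fst z < fst w \<and> (\<forall>q\<in>P. fst q < fst w \<longrightarrow> fst q < fst z)"
        show False
        proof (rule bond_insert[OF av f j _ w(1) g zP _ zw2])
          show "f i \<in> P" if "i < length p" "i \<noteq> j" for i using P that by blast
          show "fst z < fst w" using a by blast
          show "fst q < fst z" if "q \<in> P" "fst q < fst w" for q using a that by blast
          show "snd w \<le> snd (f i)" if "i < length p" "i \<noteq> j" "snd z < snd (f i)" for i
            using w_le[of i] that eq uz(1) by (cases "i = 0") auto
        qed
      next
        assume a: "fst w < fst z \<and> (\<forall>q\<in>P. fst w < fst q \<longrightarrow> fst z < fst q) \<and>
          (\<forall>q\<in>P-K. fst u < fst q \<longrightarrow> fst w \<le> fst q)"
        \<comment> \<open>Now \<open>w\<close> is the leftmost point outside \<open>K\<close> to the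
          right of \<open>u\<close>. Entry 1 is higher than \<open>w\<close>, hence strictly right
          of it and so right of \<open>z\<close>, yet it precedes \<open>z\<close> in the
          copy.\<close>
        have "f 1 \<noteq> w" using w_le[of j'] f1(3) dag' \<open>j = i'\<close> by auto
        have "fst w \<le> fst (f 1)" using a f1 f1K by blast
        moreover have "fst w \<noteq> fst (f 1)"
          using genericD(2)[OF g w(1) f1(1)] \<open>f 1 \<noteq> w\<close> by auto
        ultimately have "fst z < fst (f 1)" using a f1(1) by auto
        then show False using f1(4) by linarith
      qed
    next
      case f0K: False
      then have ne: "snd (f 0) < snd u" using f0u genericD(3)[OF g f0(3) uP] u(1) by fastforce
      \<comment> \<open>A first entry to the left of \<open>K\<close> would be above the
        left-to-right minimum \<open>m\<close>, but it is lower than \<open>u\<close>.\<close>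
      have r0: "fst k < fst (f 0)" if "k \<in> K" for k
      proof (rule ccontr)
        assume "\<not> ?thesis"
        then have "fst (f 0) < fst k"
          using genericD(2)[OF g f0(3), of k] that KP f0K by fastforce
        then have "fst (f 0) < fst m" using convex_outside(1)[OF g K f0(3) f0K that m(1)] by blast
        then have "snd m < snd (f 0)" using m(2) f0(3) unfolding lr_min_def by blast
        then show False using u(2)[OF m(1)] ne by linarith
      qed
      from zw show False
      proof
        assume a: "fst z < fst w \<and> (\<forall>q\<in>P. fst q < fst w \<longrightarrow> fst q < fst z)"
        show False
        proof (rule bond_insert[OF av f j _ w(1) g zP _ zw2])
          show "f i \<in> P" if "i < length p" "i \<noteq> j" for i using P that by blast
          show "fst z < fst w" using a by blast
          show "fst q < fst z" if "q \<in> P" "fst q < fst w" for q using a that by blast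
          show "snd w \<le> snd (f i)" if i: "i < length p" "i \<noteq> j" "snd z < snd (f i)" for i
          proof (rule w_min)
            have r: "fst k < fst (f i)" if "k \<in> K" for k
              using r0[OF that] occurrence_first(1)[OF f _ i(1)] by (cases "i = 0") auto
            then show "fst u < fst (f i)" using u(1) by blast
            show "f i \<in> P - K" using r P[OF i(1,2)] by fastforce
            show "snd u < snd (f i)" using i(3) uz(1) by linarith
          qed
        qed
      next
        assume a: "fst w < fst z \<and> (\<forall>q\<in>P. fst w < fst q \<longrightarrow> fst z < fst q) \<and>
          (\<forall>q\<in>P-K. fst u < fst q \<longrightarrow> fst w \<le> fst q)"
        \<comment> \<open>\<open>f 0\<close> is below \<open>u\<close>, so it is not
          \<open>w\<close>; it would lie to the right of \<open>w\<close> and therefore of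
          \<open>z\<close>, which it precedes.\<close>
        then have "fst w \<le> fst (f 0)" using r0[OF u(1)] f0 f0K by blast
        moreover have "fst w \<noteq> fst (f 0)"
          using genericD(2)[OF g w(1) f0(3)] ne w(3) by auto
        ultimately have "fst z < fst (f 0)" using a f0(3) by auto
        then show False using f0(1) by linarith
      qed
    qed
  qed
qed

section \<open>Removing sum and skew decompositions\<close>

text \<open>From left to right the new order is \<open>A\<close>, \<open>q\<close>,
  \<open>z\<close>, \<open>B\<close>, with \<open>q\<close> just below the top \<open>k\<close> of
  \<open>B\<close> and \<open>z\<close> just above the bottom \<open>u\<close> of \<open>A\<close>.
  A cut separating \<open>A\<close> from \<open>B\<close> must keep \<open>z\<close> on the left
  because of \<open>u\<close>, hence also \<open>q\<close>, but \<open>q\<close> is below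
  \<open>k\<close>. All cuts of \<open>Q\<close> restrict injectively to other cuts of
  \<open>P\<close>, so their number drops.\<close>

lemma skew_link:
  assumes g: "generic P" and av: "avoids p P" and s: "sum_indec P" and cut: "skew_cut P A (P - A)"
  obtains Q where "P \<subseteq> Q" "generic Q" "avoids p Q" "sum_indec Q"
    "card {C. skew_cut Q C (Q - C)} < card {C. skew_cut P C (P - C)}"
proof -
  define B where "B = P - A"
  have fin: "finite P" using genericD(1)[OF g] .
  have AB: "A \<noteq> {}" "B \<noteq> {}" "A \<union> B = P"
    and lt: "\<And>a b. a \<in> A \<Longrightarrow> b \<in> B \<Longrightarrow> fst a < fst b" "\<And>a b. a \<in> A \<Longrightarrow> b \<in> B \<Longrightarrow> snd b < snd a"
    using cut unfolding skew_cut_def B_def by auto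
  have finAB: "finite A" "finite B" using fin AB(3) by auto
  obtain u where u: "u \<in> A" "\<And>a. a \<in> A \<Longrightarrow> snd u \<le> snd a" using ex_least[OF finAB(1) AB(1)] by metis
  obtain k where k: "k \<in> B" "\<And>b. b \<in> B \<Longrightarrow> snd b \<le> snd k"
    using ex_least[OF finAB(2) AB(2), of "\<lambda>b. - snd b"] by (metis neg_le_iff_le)
  obtain l where l: "l \<in> B" "\<And>b. b \<in> B \<Longrightarrow> fst l \<le> fst b" using ex_least[OF finAB(2) AB(2)] by metis
  obtain x where x: "x < fst l" "\<And>t. t \<in> fst ` P \<Longrightarrow> t < fst l \<Longrightarrow> t < x"
    using gap_left[of "fst ` P" "fst l"] fin by blast
  \<comment> \<open>Including \<open>x\<close> among the positions to be passed puts
    \<open>z\<close> to the right of \<open>q\<close>, still to the left of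
    \<open>B\<close>.\<close>
  obtain x' where x': "x' < fst l" "\<And>t. t \<in> insert x (fst ` P) \<Longrightarrow> t < fst l \<Longrightarrow> t < x'"
    using gap_left[of "insert x (fst ` P)" "fst l"] fin by blast
  obtain y where y: "y < snd k" "\<And>t. t \<in> snd ` P \<Longrightarrow> t < snd k \<Longrightarrow> t < y"
    using gap_left[of "snd ` P" "snd k"] fin by blast
  obtain y' where y': "snd u < y'" "\<And>t. t \<in> snd ` P \<Longrightarrow> snd u < t \<Longrightarrow> y' < t"
    using gap_right[of "snd ` P" "snd u"] fin by blast
  define q where "q = (x, y)"
  define z where "z = (x', y')"
  define Q where "Q = insert z (insert q P)"
  have yy': "y < y'" using y(1) y'(1) lt(2)[OF u(1) k(1)] by linarith
  have xx': "x < x'" using x x'(2) by blast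
  have Ax: "fst a < x" if "a \<in> A" for a using x(2) lt(1)[OF that l(1)] AB(3) that by blast
  have Bx: "x' < fst b" if "b \<in> B" for b using x'(1) l(2)[OF that] by linarith
  have new: "x \<notin> fst ` P" "x' \<notin> fst ` P" "y \<notin> snd ` P" "y' \<notin> snd ` P"
    using x x'(1) x'(2) y y' by (meson insertI2 less_irrefl)+
  have gq: "generic (insert q P)" using generic_insert[OF g, of q] new unfolding q_def by simp
  have gQ: "generic Q"
    unfolding Q_def using generic_insert[OF gq, of z] new xx' yy' unfolding q_def z_def by simp
  have avQ: "avoids p Q"
    unfolding Q_def
  proof (rule avoids_skew_link[OF g av _ u k])
    show "skew_cut P A B" using cut unfolding B_def .
    show "fst a < fst q" if "a \<in> A" for a using Ax[OF that] by (simp add: q_def)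
    show "fst q < fst z" using xx' by (simp add: q_def z_def)
    show "fst z < fst b" if "b \<in> B" for b using Bx[OF that] by (simp add: z_def)
    show "snd q < snd k" using y by (simp add: q_def)
    show "snd b < snd q" if "b \<in> P" "snd b < snd k" for b using y(2) that by (simp add: q_def)
    show "snd u < snd z" using y' by (simp add: z_def)
    show "snd z < snd a" if "a \<in> P" "snd u < snd a" for a using y'(2) that by (simp add: z_def)
  qed
  have uk: "u \<in> P" "k \<in> P" using u k AB by auto
  have "sum_indec (insert q P)"
    using sum_indec_insert[OF s uk, of q] Ax[OF u(1)] xx' Bx[OF k(1)] by (auto simp: q_def)
  then have sQ: "sum_indec Q"
    unfolding Q_def using sum_indec_insert[of "insert q P" u k z] Ax[OF u(1)] xx' Bx[OF k(1)] uk
    by (auto simp: z_def)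
  have PQ: "P \<subseteq> Q" unfolding Q_def by blast
  have qz: "q \<in> Q" "z \<in> Q" "q \<notin> P" "z \<notin> P" using new unfolding Q_def q_def z_def by force+
  have sides: "(q \<in> C \<or> z \<in> C \<longrightarrow> A \<subseteq> C) \<and> (q \<notin> C \<or> z \<notin> C \<longrightarrow> B \<inter> C = {})"
    if c: "skew_cut Q C (Q - C)" for C
  proof -
    have cl: "fst a < fst b" if "a \<in> C" "b \<in> Q - C" for a b using c that unfolding skew_cut_def by blast
    have 1: "a \<in> C" if "a \<in> A" "q \<in> C \<or> z \<in> C" for a
    proof (rule ccontr)
      assume "a \<notin> C"
      then have "a \<in> Q - C" using that AB PQ by auto
      then show False using cl[of q a] cl[of z a] Ax[OF that(1)] xx' that(2) unfolding q_def z_def by auto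
    qed
    have 2: "b \<notin> C" if "b \<in> B" "q \<notin> C \<or> z \<notin> C" for b
    proof
      assume "b \<in> C"
      then show False using cl[of b q] cl[of b z] qz Bx[OF that(1)] xx' that(2) unfolding q_def z_def by auto
    qed
    show ?thesis using 1 2 by blast
  qed
  \<comment> \<open>By \<open>sides\<close>, a left part inside \<open>{q, z}\<close> would contain
    \<open>A\<close>, and a right part inside \<open>{q, z}\<close> would contain \<open>B\<close>;
    so both parts meet \<open>P\<close>.\<close>
  have trace: "skew_cut P (C \<inter> P) (P - C \<inter> P) \<and> C \<inter> P \<noteq> A" if c: "skew_cut Q C (Q - C)" for C
  proof -
    have CQ: "C \<subseteq> Q" "C \<noteq> {}" "Q - C \<noteq> {}" using c unfolding skew_cut_def by auto
    have cl: "fst a < fst b" "snd b < snd a" if "a \<in> C" "b \<in> Q - C" for a b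
      using c that unfolding skew_cut_def by blast+
    have "C \<inter> P \<noteq> {}" using sides[OF c] CQ(1,2) AB unfolding Q_def by blast
    moreover have "P - C \<inter> P \<noteq> {}" using sides[OF c] CQ(3) AB unfolding Q_def by blast
    moreover have "C \<inter> P \<noteq> A"
    proof
      assume e: "C \<inter> P = A"
      then have uC: "u \<in> C" and kC: "k \<in> Q - C" using u k AB PQ uk unfolding B_def by auto
      have "z \<in> C"
      proof (rule ccontr)
        assume "z \<notin> C"
        then show False using cl(2)[OF uC, of z] qz y'(1) by (simp add: z_def)
      qed
      then have "q \<in> C" using cl(1)[of z q] qz xx' by (auto simp: z_def q_def)
      then show False using cl(2)[OF _ kC] y(1) by (fastforce simp: q_def)
    qed
    ultimately show ?thesis using cl PQ unfolding skew_cut_def by blast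
  qed
  \<comment> \<open>Cuts with equal traces differ at most in \<open>q\<close> and \<open>z\<close>.
    If just one of them contains such a point, \<open>sides\<close> forces the common trace to be
    \<open>A\<close>, which \<open>trace\<close> excludes.\<close>
  have inj: "inj_on (\<lambda>C. C \<inter> P) {C. skew_cut Q C (Q - C)}"
  proof (rule inj_onI)
    fix C D assume C: "C \<in> {C. skew_cut Q C (Q - C)}" and D: "D \<in> {C. skew_cut Q C (Q - C)}" and e: "C \<inter> P = D \<inter> P"
    have CD: "C \<subseteq> Q" "D \<subseteq> Q" using C D unfolding skew_cut_def by auto
    have neA: "C \<inter> P \<noteq> A" using trace C by blast
    have False if E: "v \<in> E" "v \<notin> F" "v = q \<or> v = z" "E \<inter> P = F \<inter> P" "E \<inter> P \<noteq> A"
      "skew_cut Q E (Q - E)" "skew_cut Q F (Q - F)" for E F v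
    proof -
      have "A \<subseteq> E" "B \<inter> F = {}" using sides[OF E(6)] sides[OF E(7)] E(1,2,3) by auto
      then have "E \<inter> P = A" using E(4) AB by blast
      then show False using E(5) by blast
    qed
    from this[of q C D] this[of z C D] this[of q D C] this[of z D C] e neA C D have "q \<in> C \<longleftrightarrow> q \<in> D" "z \<in> C \<longleftrightarrow> z \<in> D"
      unfolding mem_Collect_eq by metis+
    then show "C = D" using e CD unfolding Q_def by blast
  qed
  have finC: "finite {C. skew_cut P C (P - C)}"
    using finite_subset[of "{C. skew_cut P C (P - C)}" "Pow P"] fin unfolding skew_cut_def by blast
  have "(\<lambda>C. C \<inter> P) ` {C. skew_cut Q C (Q - C)} \<subset> {C. skew_cut P C (P - C)}"
  proof
    show "(\<lambda>C. C \<inter> P) ` {C. skew_cut Q C (Q - C)} \<subseteq> {C. skew_cut P C (P - C)}"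
      using trace by auto
    have "A \<notin> (\<lambda>C. C \<inter> P) ` {C. skew_cut Q C (Q - C)}" using trace by auto
    then show "(\<lambda>C. C \<inter> P) ` {C. skew_cut Q C (Q - C)} \<noteq> {C. skew_cut P C (P - C)}"
      using cut by (metis mem_Collect_eq)
  qed
  then have "card {C. skew_cut Q C (Q - C)} < card {C. skew_cut P C (P - C)}"
    using psubset_card_mono[OF finC] card_image[OF inj] by metis
  then show ?thesis using that[OF PQ gQ avQ sQ] by blast
qed

lemma extend_skew_indec:
  assumes "generic P" "avoids p P" "sum_indec P"
  shows "\<exists>Q. P \<subseteq> Q \<and> generic Q \<and> avoids p Q \<and> sum_indec Q \<and> skew_indec Q"
  using assms
proof (induction "card {C. skew_cut P C (P - C)}" arbitrary: P rule: less_induct)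
  case less
  show ?case
  proof (cases "skew_indec P")
    case False
    then obtain A B where c: "skew_cut P A B" unfolding skew_indec_def by blast
    then have "B = P - A" unfolding skew_cut_def by fastforce
    then obtain Q where Q: "P \<subseteq> Q" "generic Q" "avoids p Q" "sum_indec Q"
      "card {C. skew_cut Q C (Q - C)} < card {C. skew_cut P C (P - C)}"
      using skew_link[OF less.prems] c by metis
    then show ?thesis using less.hyps[OF Q(5,2,3,4)] by blast
  qed (use less.prems in blast)
qed

text \<open>In a direct sum the rightmost point belongs to the upper part and the lowest point to
  the lower part. The new bottom-right corner is both.\<close>

lemma extend_sum_indec:
  assumes g: "generic P" and av: "avoids p P" and ne: "P \<noteq> {}"
  shows "\<exists>Q. P \<subseteq> Q \<and> generic Q \<and> avoids p Q \<and> sum_indec Q"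
proof -
  have fin: "finite P" using genericD(1)[OF g] .
  define x where "x = Max (fst ` P) + 1"
  define y where "y = Min (snd ` P) - 1"
  have x: "\<forall>q\<in>P. fst q < x"
  proof
    fix q assume "q \<in> P"
    then have "fst q \<le> Max (fst ` P)" using fin by simp
    then show "fst q < x" unfolding x_def by linarith
  qed
  have y: "\<forall>q\<in>P. y < snd q"
  proof
    fix q assume "q \<in> P"
    then have "Min (snd ` P) \<le> snd q" using fin by simp
    then show "y < snd q" unfolding y_def by linarith
  qed
  let ?Q = "insert (x, y) P"
  have "generic ?Q" using generic_insert[OF g, of "(x, y)"] x y by fastforce
  moreover have "avoids p ?Q" using avoids_corner[OF av, of "(x, y)"] x y by simp
  moreover have "sum_indec ?Q"
    unfolding sum_indec_def
  proof (intro allI notI)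
    fix A B assume c: "sum_cut ?Q A B"
    then have ne': "A \<noteq> {}" "B \<noteq> {}" "A \<union> B = ?Q"
      and lt: "\<And>a b. a \<in> A \<Longrightarrow> b \<in> B \<Longrightarrow> fst a < fst b" "\<And>a b. a \<in> A \<Longrightarrow> b \<in> B \<Longrightarrow> snd a < snd b"
      unfolding sum_cut_def by auto
    consider "(x, y) \<in> A" | "(x, y) \<in> B" using ne'(3) by blast
    then show False
    proof cases
      case 1
      obtain b where b: "b \<in> B" using ne' by blast
      then have "b \<in> ?Q" using ne'(3) by blast
      with x lt(1)[OF 1 b] show False by fastforce
    next
      case 2
      obtain a where a: "a \<in> A" using ne' by blast
      then have "a \<in> ?Q" using ne'(3) by blast
      with y lt(2)[OF a 2] show False by fastforce
    qed
  qed
  ultimately show ?thesis by blast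
qed

section \<open>Breaking intervals\<close>

lemma finite_intervals: "generic P \<Longrightarrow> finite (intervals P)" "generic P \<Longrightarrow> finite (lr_intervals P)"
proof -
  assume g: "generic P"
  have "intervals P \<subseteq> Pow P" unfolding intervals_def convex_in_def by blast
  then show "finite (intervals P)" using genericD(1)[OF g] finite_subset by blast
  then show "finite (lr_intervals P)" unfolding lr_intervals_def by simp
qed

text \<open>The point inserted beside \<^term>\<open>w\<close> is never horizontally adjacent to \<^term>\<open>K\<close>, so by
  maximality of \<^term>\<open>K\<close> it lies in no interval containing a left-to-right minimum.\<close>
lemma break_lr_interval:
  assumes g: "generic P" and av: "avoids p P" and s: "sum_indec P" "skew_indec P"
    and ne: "lr_intervals P \<noteq> {}"
  obtains Q where "P \<subseteq> Q" "generic Q" "avoids p Q" "sum_indec Q" "skew_indec Q"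
    "lr_intervals Q \<subset> lr_intervals P"
proof -
  have fin: "finite P" using genericD(1)[OF g] .
  from ex_least[OF finite_intervals(2)[OF g] ne, of "\<lambda>K. - real (card K)"] obtain K where K: "K \<in> lr_intervals P"
    and max: "\<And>L. L \<in> lr_intervals P \<Longrightarrow> card L \<le> card K"
    by (metis neg_le_iff_le of_nat_le_iff)
  from K obtain m where cK: "convex_in P K" and K2: "2 \<le> card K" and KneP: "K \<noteq> P"
    and m: "m \<in> K" "lr_min P m"
    unfolding lr_intervals_def intervals_def by blast
  have KP: "K \<subseteq> P" using convex_inD(1)[OF cK] .
  have finK: "finite K" using fin KP finite_subset by blast
  obtain u where u: "u \<in> K" "\<And>k. k \<in> K \<Longrightarrow> snd u \<le> snd k"
    using ex_least[OF finK, of snd] m(1) by (metis empty_iff)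
  have uP: "u \<in> P" using u KP by blast
  \<comment> \<open>A point left of \<open>K\<close> is left of the left-to-right minimum
    \<open>m\<close>, hence above \<open>m\<close> and above all of \<open>K\<close>.\<close>
  have left_above: "snd k < snd q" if "q \<in> P" "q \<notin> K" "k0 \<in> K" "fst q < fst k0" "k \<in> K" for q k0 k
  proof -
    have "fst q < fst m" using convex_outside(1)[OF g cK that(1-3) m(1)] that(4) by blast
    then have "snd m < snd q" using m(2) that(1) unfolding lr_min_def by blast
    then show ?thesis using convex_outside(4)[OF g cK that(1,2) m(1) that(5)] by blast
  qed
  define J where "J = {q \<in> P - K. fst u < fst q \<and> snd u < snd q}"
  have "J \<noteq> {}"
  \<comment> \<open>If no point were above and to the right, the points right of \<open>K\<close>
    would lie below it and those left of \<open>K\<close> above it, which gives a skew cut next to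
    \<open>K\<close>.\<close>
  proof
    assume J: "J = {}"
    define L where "L = {q \<in> P - K. fst q < fst u}"
    define R where "R = {q \<in> P - K. fst u < fst q}"
    have P_eq: "P = L \<union> K \<union> R" unfolding L_def R_def
      using KP genericD(2)[OF g _ uP] u(1) by fastforce
    have Lk: "fst a < fst k" "snd k < snd a" if "a \<in> L" "k \<in> K" for a k
      using that convex_outside(1)[OF g cK _ _ u(1)] left_above[OF _ _ u(1)] unfolding L_def by auto
    have Rk: "fst k < fst b" "snd b < snd k" if "b \<in> R" "k \<in> K" for b k
    proof -
      have b: "b \<in> P" "b \<notin> K" "fst u < fst b" using that unfolding R_def by auto
      show "fst k < fst b" using convex_outside(2)[OF g cK b(1,2) u(1) that(2)] b(3) by blast
      have "\<not> snd u < snd b" using J b unfolding J_def by blast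
      moreover have "snd b \<noteq> snd u" using genericD(3)[OF g b(1) uP] b(2) u(1) by auto
      ultimately show "snd b < snd k" using u(2)[OF that(2)] by linarith
    qed
    have "skew_cut P L (K \<union> R) \<or> skew_cut P (L \<union> K) R"
    proof (cases "R = {}")
      case True
      then have "L \<noteq> {}" using P_eq KneP by auto
      then show ?thesis using True P_eq m(1) Lk unfolding skew_cut_def by auto
    next
      case False
      have "fst a < fst b" "snd b < snd a" if "a \<in> L \<union> K" "b \<in> R" for a b
        using that Lk[OF _ u(1), of a] Rk[OF that(2)] u(1) by fastforce+
      then show ?thesis using False P_eq m(1) unfolding skew_cut_def by auto
    qed
    then show False using s(2) unfolding skew_indec_def by blast
  qed
  moreover have "finite J" unfolding J_def using fin by simp
  ultimately obtain w where wJ: "w \<in> J" and w_min: "\<And>q. q \<in> J \<Longrightarrow> snd w \<le> snd q"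
    using ex_least[of J snd] by metis
  have w: "w \<in> P" "w \<notin> K" "fst u < fst w" "snd u < snd w" using wJ unfolding J_def by auto
  have Kw: "fst k < fst w" "snd k < snd w" if "k \<in> K" for k
    using convex_outside(2,4)[OF g cK w(1,2) u(1) that] w(3,4) by blast+
  obtain y where y: "snd u < y" "\<And>t. t \<in> snd ` P \<Longrightarrow> snd u < t \<Longrightarrow> y < t"
    using gap_right[of "snd ` P" "snd u"] fin by blast
  have ynew: "y \<notin> snd ` P" using y by blast
  \<comment> \<open>\<open>v\<close> is an outside point separating \<open>z\<close> from
    \<open>K\<close> horizontally. If a point lies between \<open>K\<close> and \<open>w\<close>,
    then \<open>z\<close> goes just left of \<open>w\<close>; otherwise it goes just right of
    \<open>w\<close>, with \<open>w\<close> itself as \<open>v\<close>.\<close>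
  have "\<exists>x. x \<notin> fst ` P \<and> (\<exists>v\<in>P-K. fst u < fst v \<and> fst v < x) \<and>
      ((x < fst w \<and> (\<forall>q\<in>P. fst q < fst w \<longrightarrow> fst q < x)) \<or>
       (fst w < x \<and> (\<forall>q\<in>P. fst w < fst q \<longrightarrow> x < fst q) \<and>
        (\<forall>q\<in>P-K. fst u < fst q \<longrightarrow> fst w \<le> fst q)))"
  proof (cases "\<exists>v\<in>P-K. fst u < fst v \<and> fst v < fst w")
    case True
    obtain x where x: "x < fst w" "\<And>t. t \<in> fst ` P \<Longrightarrow> t < fst w \<Longrightarrow> t < x"
      using gap_left[of "fst ` P" "fst w"] fin by blast
    from x have "x \<notin> fst ` P" by blast
    then show ?thesis using x True by (intro exI[of _ x]) auto
  next
    case False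
    obtain x where x: "fst w < x" "\<And>t. t \<in> fst ` P \<Longrightarrow> fst w < t \<Longrightarrow> x < t"
      using gap_right[of "fst ` P" "fst w"] fin by blast
    from x have "x \<notin> fst ` P" by blast
    moreover have "\<forall>q\<in>P-K. fst u < fst q \<longrightarrow> fst w \<le> fst q" using False by force
    ultimately show ?thesis using x w by (intro exI[of _ x]) auto
  qed
  then obtain x v where xnew: "x \<notin> fst ` P" and v: "v \<in> P" "v \<notin> K" "fst u < fst v" "fst v < x"
    and xw: "(x < fst w \<and> (\<forall>q\<in>P. fst q < fst w \<longrightarrow> fst q < x)) \<or>
       (fst w < x \<and> (\<forall>q\<in>P. fst w < fst q \<longrightarrow> x < fst q) \<and>
        (\<forall>q\<in>P-K. fst u < fst q \<longrightarrow> fst w \<le> fst q))" by blast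
  define z where "z = (x, y)"
  define Q where "Q = insert z P"
  have Kv: "fst k < fst v" if "k \<in> K" for k
    using convex_outside(2)[OF g cK v(1,2) u(1) that] v(3) by blast
  have Kx: "fst k < x" if "k \<in> K" for k using Kv[OF that] v(4) by linarith
  have PQ: "P \<subseteq> Q" unfolding Q_def by blast
  have gQ: "generic Q" unfolding Q_def using generic_insert[OF g, of z] xnew ynew by (simp add: z_def)
  have avQ: "avoids p Q"
    unfolding Q_def
  proof (rule avoids_interval_breaker[OF g av cK m u w(1,3,4,2)])
    show "snd w \<le> snd q" if "q \<in> P - K" "fst u < fst q" "snd u < snd q" for q
      using w_min that unfolding J_def by blast
    show "snd z < snd q" if "q \<in> P" "snd u < snd q" for q using y(2) that by (simp add: z_def)
  qed (use xnew ynew Kx y xw in \<open>auto simp: z_def\<close>)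
  obtain k where k: "k \<in> K" "k \<noteq> u"
    using ex_other[OF K2] by metis
  have kP: "k \<in> P" using k KP by blast
  have uk: "snd u < snd k" using u(2)[OF k(1)] genericD(3)[OF g kP uP] k(2) by fastforce
  then have yk: "y < snd k" using y(2) kP by blast
  have sQ: "sum_indec Q" "skew_indec Q"
    unfolding Q_def using sum_indec_insert[OF s(1) uP kP, of z] skew_indec_insert[OF s(2) uP kP, of z] y(1) yk
    by (auto simp: z_def)
  have zP: "z \<notin> P" using xnew by (auto simp: z_def image_iff)
  have sub: "L \<in> lr_intervals P \<and> L \<noteq> K" if L: "L \<in> lr_intervals Q" for L
  proof -
    from L obtain n where cL: "convex_in Q L" and L2: "2 \<le> card L" and LneQ: "L \<noteq> Q"
      and n: "n \<in> L" "lr_min Q n"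
      unfolding lr_intervals_def intervals_def by blast
    have nz: "n \<noteq> z" using n(2) uP Kx[OF u(1)] y(1) unfolding lr_min_def Q_def z_def by fastforce
    have nP: "n \<in> P" "lr_min P n" using n nz unfolding lr_min_def Q_def by auto
    have cLP: "convex_in P (L \<inter> P)" using convex_in_restrict[OF cL PQ] .
    have zL: "z \<notin> L"
    proof
      assume zL: "z \<in> L"
      \<comment> \<open>\<open>z\<close> lies between \<open>u\<close> and \<open>k\<close> in
        height, with no point of \<open>P\<close> between \<open>u\<close> and \<open>z\<close>. If
        \<open>n\<close> is no higher than \<open>u\<close>, convexity puts \<open>u\<close> into
        \<open>L\<close>; otherwise \<open>n\<close> is between \<open>u\<close> and
        \<open>k\<close> and lies in \<open>K\<close>, or \<open>k\<close> lies in
        \<open>L\<close>.\<close>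
      have "\<exists>c. c \<in> L \<inter> K"
      proof -
        consider "snd n < y" | "y < snd n" using ynew nP(1) by (metis image_eqI linorder_neqE_linordered_idom)
        then show ?thesis
        proof cases
          case 1
          then have "snd n \<le> snd u" using y(2) nP(1) by fastforce
          then have "n = u \<or> snd n < snd u" using genericD(3)[OF g nP(1) uP] by fastforce
          then have "u \<in> L" using convex_inD(3)[OF cL n(1) zL, of u] n(1) uP y(1) PQ by (auto simp: z_def)
          then show ?thesis using u(1) by blast
        next
          case 2
          then have "snd u < snd n" using y(1) by linarith
          consider "n = k" | "snd n < snd k" | "snd k < snd n"
            using genericD(3)[OF g nP(1) kP] by fastforce
          then show ?thesis
          proof cases
            case 2
            then have "n \<in> K" using convex_inD(3)[OF cK u(1) k(1) nP(1)] \<open>snd u < snd n\<close> by blast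
            then show ?thesis using n(1) by blast
          next
            case 3
            then have "k \<in> L" using convex_inD(3)[OF cL zL n(1), of k] kP yk PQ by (auto simp: z_def)
            then show ?thesis using k(1) by blast
          qed (use k n in blast)
        qed
      qed
      then obtain c where c: "c \<in> L" "c \<in> K" by blast
      \<comment> \<open>\<open>v\<close> lies between \<open>c\<close> and \<open>z\<close>, so
        \<open>L\<close> reaches outside \<open>K\<close> and the union is strictly larger than
        \<open>K\<close>.\<close>
      have vL: "v \<in> L" using convex_inD(2)[OF cL c(1) zL, of v] Kv[OF c(2)] v(1,4) PQ by (auto simp: z_def)
      have cU: "convex_in P (L \<inter> P \<union> K)" using convex_in_Un[OF g cLP cK, of c] c KP by blast
      have "card K < card (L \<inter> P \<union> K)"
        using psubset_card_mono[of "L \<inter> P \<union> K" K] vL v(1,2) finK fin by blast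
      \<comment> \<open>By maximality of \<open>K\<close> the union is not a proper interval, so
        \<open>L\<close> and \<open>K\<close> cover \<open>P\<close>; indecomposability excludes
        this.\<close>
      moreover from this have "L \<inter> P \<union> K = P"
        using max[of "L \<inter> P \<union> K"] cU m K2 unfolding lr_intervals_def intervals_def by fastforce
      moreover have "L \<inter> P \<noteq> P" using LneQ zL cL unfolding Q_def convex_in_def by blast
      moreover have "L \<inter> P \<noteq> {}" using vL v(1) by blast
      ultimately show False using covering_pair_decomposes[OF g cLP cK] KneP s by blast
    qed
    then have LP: "L \<subseteq> P" using convex_inD(1)[OF cL] unfolding Q_def by blast
    have "\<not> (u \<in> L \<and> k \<in> L)"
      using convex_inD(3)[OF cL, of u k z] zL y(1) yk unfolding Q_def by (auto simp: z_def)
    then have "L \<noteq> P" "L \<noteq> K" using uP kP u(1) k(1) by auto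
    then show ?thesis using convex_in_subset[OF cL PQ LP] L2 n(1) nP(2)
      unfolding lr_intervals_def intervals_def by blast
  qed
  then have "lr_intervals Q \<subset> lr_intervals P" using K by blast
  then show ?thesis using that[OF PQ gQ avQ sQ] by blast
qed

text \<open>The position of \<open>z\<close> cuts \<open>K\<close> between \<open>c\<close> and
  \<open>d\<close>, and its height is just below \<open>m\<close>, the lowest point to its left. An
  interval through \<open>z\<close> would meet \<open>K\<close> and so contain \<open>m\<close>, but
  no proper interval of \<open>P\<close> contains a left-to-right minimum.\<close>

lemma break_interval:
  assumes g: "generic P" and av: "avoids p P" and lr: "lr_intervals P = {}"
    and ne: "intervals P \<noteq> {}"
  obtains Q where "P \<subseteq> Q" "generic Q" "avoids p Q" "lr_intervals Q = {}" "intervals Q \<subset> intervals P"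
proof -
  have fin: "finite P" using genericD(1)[OF g] .
  obtain K where K: "K \<in> intervals P" using ne by blast
  then have cK: "convex_in P K" and K2: "2 \<le> card K" and KneP: "K \<noteq> P"
    unfolding intervals_def by auto
  have noK: "\<not> lr_min P m" if "m \<in> K" for m using K lr that unfolding lr_intervals_def by blast
  have KP: "K \<subseteq> P" using convex_inD(1)[OF cK] .
  obtain c d where "c \<in> K" "d \<in> K" "c \<noteq> d"
    using ex_other[OF K2] by metis
  then have "\<exists>c\<in>K. \<exists>d\<in>K. fst c < fst d"
    using genericD(2)[OF g] KP by (metis linorder_neqE_linordered_idom subsetD)
  then obtain c d where c: "c \<in> K" and d: "d \<in> K" and cd: "fst c < fst d" by blast
  have cP: "c \<in> P" "d \<in> P" using c d KP by auto
  obtain x where x: "x < fst d" "\<And>t. t \<in> fst ` P \<Longrightarrow> t < fst d \<Longrightarrow> t < x"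
    using gap_left[of "fst ` P" "fst d"] fin by blast
  have xnew: "x \<notin> fst ` P" using x by blast
  have cx: "fst c < x" using x(2) cd cP by blast
  define S where "S = {q \<in> P. fst q < x}"
  have "finite S" "c \<in> S" using fin cP(1) cx unfolding S_def by simp_all
  then have "finite S" "S \<noteq> {}" by auto
  from ex_least[OF this, of snd] obtain m where mS: "m \<in> S" "\<And>q. q \<in> S \<Longrightarrow> snd m \<le> snd q" by metis
  have m: "m \<in> P" "fst m < x" using mS(1) unfolding S_def by auto
  have m_min: "snd m \<le> snd q" if "q \<in> P" "fst q < x" for q using mS(2) that unfolding S_def by simp
  have lm: "lr_min P m" unfolding lr_min_def
  proof (intro conjI ballI impI)
    fix q assume q: "q \<in> P" "fst q < fst m"
    then have "snd q \<noteq> snd m" using genericD(3)[OF g q(1) m(1)] by auto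
    then show "snd m < snd q" using m_min[OF q(1)] q m by fastforce
  qed (rule m(1))
  have mK: "m \<notin> K" using noK lm by blast
  have "snd m < snd c" using m_min[OF cP(1) cx] genericD(3)[OF g m(1) cP(1)] mK c by fastforce
  then have mk: "snd m < snd k" if "k \<in> K" for k
    using convex_outside(3)[OF g cK m(1) mK c that] by blast
  obtain y where y: "y < snd m" "\<And>t. t \<in> snd ` P \<Longrightarrow> t < snd m \<Longrightarrow> t < y"
    using gap_left[of "snd ` P" "snd m"] fin by blast
  have ynew: "y \<notin> snd ` P" using y by blast
  define z where "z = (x, y)"
  define Q where "Q = insert z P"
  have PQ: "P \<subseteq> Q" unfolding Q_def by blast
  have gQ: "generic Q" unfolding Q_def using generic_insert[OF g, of z] xnew ynew by (simp add: z_def)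
  have avQ: "avoids p Q"
    unfolding Q_def
  proof (rule avoids_lr_min[OF g av m(1)])
    show "snd m \<le> snd q" if "q \<in> P" "fst q < fst z" for q using m_min that by (simp add: z_def)
    show "snd q < snd z" if "q \<in> P" "snd q < snd m" for q using y(2) that by (simp add: z_def)
  qed (use m y in \<open>auto simp: z_def\<close>)
  have sub: "L \<in> intervals P \<and> L \<noteq> K \<and> z \<notin> L" if L: "L \<in> intervals Q" for L
  proof -
    from L have cL: "convex_in Q L" and L2: "2 \<le> card L" and LneQ: "L \<noteq> Q"
      unfolding intervals_def by auto
    have cLP: "convex_in P (L \<inter> P)" using convex_in_restrict[OF cL PQ] .
    have LQ: "L \<subseteq> Q" using convex_inD(1)[OF cL] .
    have zL: "z \<notin> L"
    proof
      assume zL: "z \<in> L"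
      obtain n where n: "n \<in> L" "n \<noteq> z"
        using ex_other[OF L2] by metis
      then have nP: "n \<in> P" using LQ unfolding Q_def by blast
      \<comment> \<open>\<open>x\<close> lies between the positions of \<open>c\<close> and
        \<open>d\<close>, so the stretch from \<open>z\<close> to another member \<open>n\<close>
        passes \<open>c\<close> or \<open>d\<close>, or ends in \<open>K\<close>.\<close>
      have "\<exists>k. k \<in> L \<inter> K"
      proof (cases "x < fst n")
        case True
        then have "\<not> fst n < fst d" using x(2) nP by fastforce
        then have "n = d \<or> fst d < fst n" using genericD(2)[OF g nP cP(2)] by fastforce
        then have "d \<in> L" using convex_inD(2)[OF cL zL n(1), of d] n(1) x(1) cP PQ by (auto simp: z_def)
        then show ?thesis using d by blast
      next
        case False
        then have nx: "fst n < x" using xnew nP by (metis image_eqI linorder_neqE_linordered_idom)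
        consider "n = c" | "fst n < fst c" | "fst c < fst n"
          using genericD(2)[OF g nP cP(1)] by fastforce
        then show ?thesis
        proof cases
          case 2
          then have "c \<in> L" using convex_inD(2)[OF cL n(1) zL, of c] cx cP PQ by (auto simp: z_def)
          then show ?thesis using c by blast
        next
          case 3
          then have "n \<in> K" using convex_inD(2)[OF cK c d nP] nx x(1) by linarith
          then show ?thesis using n by blast
        qed (use c n in blast)
      qed
      then obtain k where k: "k \<in> L" "k \<in> K" by blast
      \<comment> \<open>In height, \<open>m\<close> lies between \<open>z\<close> and all of
        \<open>K\<close>.\<close>
      have mL: "m \<in> L" using convex_inD(3)[OF cL zL k(1), of m] mk[OF k(2)] y(1) m(1) PQ by (auto simp: z_def)
      have "finite (L \<inter> P)" using fin by simp
      moreover have "{m, k} \<subseteq> L \<inter> P" "m \<noteq> k" using mL k m(1) KP mK by auto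
      ultimately have "2 \<le> card (L \<inter> P)" using card_mono[of "L \<inter> P" "{m, k}"] by simp
      then have "L \<inter> P = P" using lr cLP mL m(1) lm unfolding lr_intervals_def intervals_def by blast
      then show False using zL LneQ LQ unfolding Q_def by blast
    qed
    then have LP: "L \<subseteq> P" using LQ unfolding Q_def by blast
    have "\<not> (c \<in> L \<and> d \<in> L)"
      using convex_inD(2)[OF cL, of c d z] zL cx x(1) unfolding Q_def by (auto simp: z_def)
    then have "L \<noteq> P" "L \<noteq> K" using cP c d by auto
    then show ?thesis using convex_in_subset[OF cL PQ LP] L2 zL unfolding intervals_def by blast
  qed
  have "lr_intervals Q = {}"
  proof (rule ccontr)
    assume "lr_intervals Q \<noteq> {}"
    then obtain L n where L: "L \<in> intervals Q" "n \<in> L" "lr_min Q n" unfolding lr_intervals_def by blast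
    then have "lr_min P n" using sub[OF L(1)] unfolding lr_min_def Q_def by auto
    then show False using sub[OF L(1)] L(2) lr unfolding lr_intervals_def by blast
  qed
  moreover have "intervals Q \<subset> intervals P" using sub K by blast
  ultimately show ?thesis using that[OF PQ gQ avQ] by blast
qed

section \<open>Iterating the insertions\<close>

lemma extend_no_lr_intervals:
  assumes "generic P" "avoids p P" "sum_indec P" "skew_indec P"
  shows "\<exists>Q. P \<subseteq> Q \<and> generic Q \<and> avoids p Q \<and> lr_intervals Q = {}"
  using assms
proof (induction "card (lr_intervals P)" arbitrary: P rule: less_induct)
  case less
  show ?case
  proof (cases "lr_intervals P = {}")
    case False
    obtain Q where Q: "P \<subseteq> Q" "generic Q" "avoids p Q" "sum_indec Q" "skew_indec Q"
      "lr_intervals Q \<subset> lr_intervals P"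
      using break_lr_interval[OF less.prems False] by metis
    then show ?thesis
      using less.hyps[OF psubset_card_mono[OF finite_intervals(2)[OF less.prems(1)] Q(6)] Q(2-5)] by blast
  qed (use less.prems in blast)
qed

lemma extend_no_intervals:
  assumes "generic P" "avoids p P" "lr_intervals P = {}"
  shows "\<exists>Q. P \<subseteq> Q \<and> generic Q \<and> avoids p Q \<and> intervals Q = {}"
  using assms
proof (induction "card (intervals P)" arbitrary: P rule: less_induct)
  case less
  show ?case
  proof (cases "intervals P = {}")
    case False
    obtain Q where Q: "P \<subseteq> Q" "generic Q" "avoids p Q" "lr_intervals Q = {}" "intervals Q \<subset> intervals P"
      using break_interval[OF less.prems False] by metis
    then show ?thesis
      using less.hyps[OF psubset_card_mono[OF finite_intervals(1)[OF less.prems(1)] Q(5)] Q(2-4)] by blast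
  qed (use less.prems in blast)
qed

text \<open>Each stage keeps what the next one uses: indecomposability is secured before intervals
  with left-to-right minima are broken, and their absence persists while the remaining intervals are
  broken.\<close>

lemma extend_simple:
  assumes "generic P" "avoids p P" "P \<noteq> {}"
  shows "\<exists>Q. P \<subseteq> Q \<and> generic Q \<and> avoids p Q \<and> intervals Q = {}"
proof -
  obtain A where A: "P \<subseteq> A" "generic A" "avoids p A" "sum_indec A"
    using extend_sum_indec[OF assms] by blast
  obtain B where B: "A \<subseteq> B" "generic B" "avoids p B" "sum_indec B" "skew_indec B"
    using extend_skew_indec[OF A(2-4)] by blast
  obtain C where C: "B \<subseteq> C" "generic C" "avoids p C" "lr_intervals C = {}"
    using extend_no_lr_intervals[OF B(2-5)] by blast
  obtain D where "C \<subseteq> D" "generic D" "avoids p D" "intervals D = {}"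
    using extend_no_intervals[OF C(2-4)] by blast
  then show ?thesis using A(1) B(1) C(1) by blast
qed

end

section \<open>Permutations in one-line notation\<close>

lemma subseq_imp_index_map:
  assumes "subseq s b"
  shows "\<exists>h. (\<forall>i<length s. h i < length b \<and> s ! i = b ! h i) \<and> (\<forall>i j. i < j \<longrightarrow> j < length s \<longrightarrow> h i < h j)"
  using assms
proof (induction rule: list_emb.induct)
  case (list_emb_Nil ys)
  then show ?case by simp
next
  case (list_emb_Cons xs ys y)
  then obtain h where "\<forall>i<length xs. h i < length ys \<and> xs ! i = ys ! h i"
    "\<forall>i j. i < j \<longrightarrow> j < length xs \<longrightarrow> h i < h j" by blast
  then show ?case by (intro exI[of _ "\<lambda>i. Suc (h i)"]) auto
next
  case (list_emb_Cons2 x y xs ys)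
  then obtain h where h: "\<forall>i<length xs. h i < length ys \<and> xs ! i = ys ! h i"
    "\<forall>i j. i < j \<longrightarrow> j < length xs \<longrightarrow> h i < h j" by blast
  define h' where "h' i = (case i of 0 \<Rightarrow> 0 | Suc i \<Rightarrow> Suc (h i))" for i
  have "h' i < length (y # ys) \<and> (x # xs) ! i = (y # ys) ! h' i" if "i < length (x # xs)" for i
    using h that list_emb_Cons2 unfolding h'_def by (cases i) auto
  moreover have "h' i < h' j" if "i < j" "j < length (x # xs)" for i j
    using h that unfolding h'_def by (cases i; cases j) auto
  ultimately show ?case by blast
qed

text \<open>The bound \<open>m\<close> serves the induction: the last index \<open>h n\<close>
  bounds all earlier ones, so the induction hypothesis applies to the prefix of length
  \<open>h n\<close>.\<close>

lemma index_map_imp_subseq: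
  assumes "\<And>i. i < n \<Longrightarrow> h i < m" "m \<le> length b" "\<And>i j. i < j \<Longrightarrow> j < n \<Longrightarrow> h i < h j"
  shows "subseq (map (\<lambda>i. b ! h i) [0..<n]) (take m b)"
  using assms
proof (induction n arbitrary: m)
  case (Suc n)
  have hn: "h n < m" "h n < length b" using Suc.prems(1)[of n] Suc.prems(2) by auto
  have "subseq (map (\<lambda>i. b ! h i) [0..<n]) (take (h n) b)"
    using Suc.IH[of "h n"] Suc.prems(3) hn(2) by simp
  then have "subseq (map (\<lambda>i. b ! h i) [0..<n] @ [b ! h n]) (take (h n) b @ [b ! h n])"
    by (rule list_emb_append_mono) simp
  also have "take (h n) b @ [b ! h n] = take (Suc (h n)) (take m b)"
    using hn by (simp add: take_Suc_conv_app_nth min_def)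
  also have "subseq \<dots> (take m b)" by (rule prefix_imp_subseq[OF take_is_prefix])
  finally show ?case by simp
qed simp

section \<open>Drawing permutations and reading them off\<close>

definition represents :: "nat list \<Rightarrow> point set \<Rightarrow> (nat \<Rightarrow> point) \<Rightarrow> bool" where
  "represents s P g \<longleftrightarrow> bij_betw g {..<length s} P \<and>
     (\<forall>i<length s. \<forall>j<length s. fst (g i) < fst (g j) \<longleftrightarrow> i < j) \<and>
     (\<forall>i<length s. \<forall>j<length s. snd (g i) < snd (g j) \<longleftrightarrow> s ! i < s ! j)"

lemma contained_in_iff_occurrence:
  assumes r: "represents s P g"
  shows "contained_in a s \<longleftrightarrow> (\<exists>f. occurrence a P f)"
proof
  assume "contained_in a s"
  then obtain t where t: "subseq t s" "order_iso t a" unfolding contained_in_def by blast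
  obtain h where h: "\<And>i. i < length t \<Longrightarrow> h i < length s" "\<And>i. i < length t \<Longrightarrow> t ! i = s ! h i"
    "\<And>i j. i < j \<Longrightarrow> j < length t \<Longrightarrow> h i < h j"
    using subseq_imp_index_map[OF t(1)] by blast
  have "length t = length a" and o: "\<And>i j. i < length t \<Longrightarrow> j < length t \<Longrightarrow> t ! i < t ! j \<longleftrightarrow> a ! i < a ! j"
    using t(2) unfolding order_iso_def by blast+
  then have "occurrence a P (\<lambda>i. g (h i))"
    using r h unfolding occurrence_def represents_def by (auto simp: bij_betw_def)
  then show "\<exists>f. occurrence a P f" by blast
next
  assume "\<exists>f. occurrence a P f"
  then obtain f where f: "occurrence a P f" by blast
  have g: "bij_betw g {..<length s} P" using r unfolding represents_def by blast
  \<comment> \<open>The position in \<open>s\<close> of the point that plays entry \<open>i\<close>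
    of the copy.\<close>
  define h where "h i = the_inv_into {..<length s} g (f i)" for i
  have h: "h i < length s" "g (h i) = f i" if "i < length a" for i
  proof -
    have "f i \<in> g ` {..<length s}" using occurrenceD(1)[OF f that] g unfolding bij_betw_def by simp
    then show "h i < length s" "g (h i) = f i"
      using the_inv_into_into[of g "{..<length s}" "f i" "{..<length s}"]
        f_the_inv_into_f[of g "{..<length s}" "f i"] g
      unfolding h_def bij_betw_def by auto
  qed
  have m: "h i < h j" if "i < j" "j < length a" for i j
  proof -
    have ij: "i < length a" "j < length a" using that by auto
    have "fst (g (h i)) < fst (g (h j))" using occurrenceD(2)[OF f that] h(2) ij by simp
    then show ?thesis using r h(1)[OF ij(1)] h(1)[OF ij(2)] unfolding represents_def by blast
  qed
  have "subseq (map (\<lambda>i. s ! h i) [0..<length a]) s"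
    using index_map_imp_subseq[of "length a" h "length s" s] h m by simp
  moreover have "order_iso (map (\<lambda>i. s ! h i) [0..<length a]) a"
    unfolding order_iso_def
  proof (intro conjI allI impI)
    fix i j
    assume "i < length (map (\<lambda>i. s ! h i) [0..<length a])" "j < length (map (\<lambda>i. s ! h i) [0..<length a])"
    then have ij: "i < length a" "j < length a" by auto
    have "s ! h i < s ! h j \<longleftrightarrow> snd (g (h i)) < snd (g (h j))"
      using r h(1)[OF ij(1)] h(1)[OF ij(2)] unfolding represents_def by blast
    also have "\<dots> \<longleftrightarrow> a ! i < a ! j" using h(2) ij occurrenceD(3)[OF f ij] by simp
    finally show "map (\<lambda>i. s ! h i) [0..<length a] ! i < map (\<lambda>i. s ! h i) [0..<length a] ! j \<longleftrightarrow> a ! i < a ! j"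
      using ij by simp
  qed simp
  ultimately show "contained_in a s" unfolding contained_in_def by blast
qed

lemma perm_representable:
  assumes "is_perm s"
  obtains P g where "generic P" "represents s P g"
proof -
  define g where "g i = (real i, real (s ! i))" for i
  have d: "distinct s" using assms permutations_of_setD(2) unfolding is_perm_def by blast
  have "bij_betw g {..<length s} (g ` {..<length s})"
    unfolding bij_betw_def g_def by (auto intro!: inj_onI)
  then have "represents s (g ` {..<length s}) g" unfolding represents_def g_def by auto
  moreover have "generic (g ` {..<length s})"
    unfolding generic_def g_def using d by (auto simp: inj_on_def nth_eq_iff_index_eq)
  ultimately show ?thesis using that by blast
qed

text \<open>This is standardisation: the points are read from left to right and each height is
  replaced by its rank.\<close>

lemma generic_represented:
  assumes g: "generic P"
  obtains s f where "is_perm s" "represents s P f"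
proof -
  have fin: "finite P" using genericD(1)[OF g] .
  define n where "n = card P"
  define xs where "xs = sorted_list_of_set (fst ` P)"
  have injf: "inj_on fst P" using g unfolding generic_def by blast
  have xs: "length xs = n" "set xs = fst ` P" "sorted_wrt (<) xs"
    using fin card_image[OF injf] strict_sorted_list_of_set unfolding xs_def n_def by auto
  define f where "f i = the_inv_into P fst (xs ! i)" for i
  have f: "f i \<in> P" "fst (f i) = xs ! i" if "i < n" for i
  proof -
    have "xs ! i \<in> fst ` P" using that xs(1) nth_mem[of i xs] unfolding xs(2)[symmetric] by simp
    then show "f i \<in> P" "fst (f i) = xs ! i"
      unfolding f_def using the_inv_into_into[OF injf] f_the_inv_into_f[OF injf] by blast+
  qed
  have flt: "fst (f i) < fst (f j) \<longleftrightarrow> i < j" if "i < n" "j < n" for i j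
  proof -
    have *: "fst (f i) < fst (f j)" if "i < j" "j < n" for i j
      using sorted_wrt_nth_less[OF xs(3), of i j] that f xs(1) by simp
    show ?thesis using *[of i j] *[of j i] that by (metis less_asym less_irrefl linorder_neqE_nat)
  qed
  have "inj_on f {..<n}"
    using flt by (intro inj_onI) (metis lessThan_iff less_irrefl linorder_neqE_nat)
  moreover from this have "f ` {..<n} = P"
    using f fin card_image[of f "{..<n}"] by (intro card_subset_eq) (auto simp: n_def)
  ultimately have bij: "bij_betw f {..<n} P" unfolding bij_betw_def by blast
  \<comment> \<open>The point itself is counted, so ranks start at 1.\<close>
  define r where "r q = card {t \<in> P. snd t \<le> snd q}" for q :: point
  have r_less: "r a < r b" if "a \<in> P" "b \<in> P" "snd a < snd b" for a b
  proof -
    have "b \<in> {t \<in> P. snd t \<le> snd b}" "b \<notin> {t \<in> P. snd t \<le> snd a}" using that by auto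
    moreover have "{t \<in> P. snd t \<le> snd a} \<subseteq> {t \<in> P. snd t \<le> snd b}" using that by auto
    ultimately show ?thesis unfolding r_def using fin by (intro psubset_card_mono) auto
  qed
  have r_iff: "r a < r b \<longleftrightarrow> snd a < snd b" if "a \<in> P" "b \<in> P" for a b
    using r_less[OF that] r_less[OF that(2,1)] genericD(3)[OF g that]
    by (metis less_asym less_irrefl linorder_neqE_linordered_idom)
  have "inj_on r P"
    using r_iff genericD(3)[OF g] by (intro inj_onI) (metis less_irrefl linorder_neqE_linordered_idom)
  moreover have "r ` P \<subseteq> {1..n}"
  proof
    fix v assume "v \<in> r ` P"
    then obtain q where q: "q \<in> P" "v = r q" by blast
    have "card {t \<in> P. snd t \<le> snd q} \<noteq> 0"
      using q(1) card_gt_0_iff[of "{t \<in> P. snd t \<le> snd q}"] fin by fastforce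
    moreover have "card {t \<in> P. snd t \<le> snd q} \<le> n" unfolding n_def using fin by (intro card_mono) auto
    ultimately show "v \<in> {1..n}" using q(2) unfolding r_def by auto
  qed
  ultimately have rP: "inj_on r P" "r ` P = {1..n}"
    using card_image[of r P] card_subset_eq[of "{1..n}" "r ` P"] by (simp_all add: n_def)
  define s where "s = map (\<lambda>i. r (f i)) [0..<n]"
  have ls: "length s = n" unfolding s_def by simp
  have "inj_on (r \<circ> f) {..<n}" using comp_inj_on[of f "{..<n}" r] bij rP(1) unfolding bij_betw_def by simp
  then have "distinct s" unfolding s_def by (simp add: distinct_map atLeast0LessThan comp_def)
  moreover have "set s = {1..n}"
  proof -
    have "set s = r ` f ` {..<n}" unfolding s_def by (auto simp: atLeast0LessThan)
    also have "\<dots> = {1..n}" using bij rP(2) unfolding bij_betw_def by simp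
    finally show ?thesis .
  qed
  ultimately have "is_perm s" unfolding is_perm_def ls by blast
  moreover have "represents s P f"
    unfolding represents_def ls
    using bij flt r_iff f(1) by (simp add: s_def)
  ultimately show ?thesis using that by blast
qed

section \<open>Simplicity and deflatability\<close>

text \<open>A proper interval of \<open>s\<close> with at least two positions is carried by
  \<open>f\<close> to a member of \<open>intervals P\<close>.\<close>

lemma simple_perm_if_no_intervals:
  assumes g: "generic P" and s: "is_perm s" and r: "represents s P f" and ne: "P \<noteq> {}"
    and no: "intervals P = {}"
  shows "simple_perm s"
proof -
  have bij: "bij_betw f {..<length s} P"
    and fl: "\<And>i j. i < length s \<Longrightarrow> j < length s \<Longrightarrow> fst (f i) < fst (f j) \<longleftrightarrow> i < j"
    and sl: "\<And>i j. i < length s \<Longrightarrow> j < length s \<Longrightarrow> snd (f i) < snd (f j) \<longleftrightarrow> s ! i < s ! j"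
    using r unfolding represents_def by blast+
  have inj: "inj_on f {..<length s}" and im: "f ` {..<length s} = P" using bij unfolding bij_betw_def by auto
  have d: "distinct s" using s permutations_of_setD(2) unfolding is_perm_def by blast
  have "is_singleton I" if I: "perm_interval s I" for I
  proof (rule ccontr)
    assume ns: "\<not> is_singleton I"
    from I have I1: "I \<noteq> {}" "I \<subseteq> {..<length s}" "I \<noteq> {..<length s}"
      unfolding perm_interval_def by auto
    from I obtain a b c e where ab: "I = {a..b}" and ce: "(!) s ` I = {c..e}"
      unfolding perm_interval_def consecutive_def by blast
    have finI: "finite I" using ab by simp
    have "card I \<noteq> 0" "card I \<noteq> 1" using finI I1 ns is_singleton_altdef by auto
    then have "2 \<le> card I" by linarith
    moreover have "card (f ` I) = card I" using card_image inj_on_subset[OF inj I1(2)] by blast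
    moreover have "f ` I \<noteq> P" using I1 inj im by (metis inj_on_image_eq_iff order_refl)
    moreover have "convex_in P (f ` I)"
    proof -
      have "f k \<in> f ` I" if i: "i \<in> I" and j: "j \<in> I" and k: "k < length s"
        and o: "(fst (f i) < fst (f k) \<and> fst (f k) < fst (f j)) \<or> (snd (f i) < snd (f k) \<and> snd (f k) < snd (f j))"
      for i j k
      proof -
        have ij: "i < length s" "j < length s" using i j I1(2) by auto
        from o have "(i < k \<and> k < j) \<or> (s ! i < s ! k \<and> s ! k < s ! j)"
          using fl[OF ij(1) k] fl[OF k ij(2)] sl[OF ij(1) k] sl[OF k ij(2)] by blast
        then have "k \<in> I"
        proof
          assume "i < k \<and> k < j" then show ?thesis using i j ab by auto
        next
          assume o: "s ! i < s ! k \<and> s ! k < s ! j"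
          have "s ! i \<in> {c..e}" "s ! j \<in> {c..e}" using i j ce by blast+
          \<comment> \<open>The values on \<open>I\<close> fill \<open>{c..e}\<close>, so
            \<open>s ! k\<close> is taken at some position of \<open>I\<close>, which is
            \<open>k\<close> by distinctness.\<close>
          then have "s ! k \<in> (!) s ` I" using o unfolding ce by simp
          then obtain l where l: "l \<in> I" "s ! k = s ! l" by blast
          then have "l < length s" using I1(2) by blast
          then show ?thesis using l d k nth_eq_iff_index_eq by metis
        qed
        then show ?thesis by blast
      qed
      moreover have "f ` I \<subseteq> P" using I1(2) im by blast
      ultimately show ?thesis unfolding convex_in_def im[symmetric] by blast
    qed
    ultimately have "f ` I \<in> intervals P" unfolding intervals_def by simp
    then show False using no by blast
  qed
  moreover have "s \<noteq> []" using ne im by auto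
  ultimately show ?thesis using s unfolding simple_perm_def by blast
qed

text \<open>A simple \<open>b\<close> in the closure of \<open>D\<close> already lies in
  \<open>D\<close>, because both have the same simple permutations; downward closure then forces
  every \<open>a\<close> of \<open>C\<close> into \<open>D\<close>.\<close>

lemma not_deflatable_if_simple_extensions:
  assumes "\<And>a. a \<in> C \<Longrightarrow> is_perm a \<and> (\<exists>b\<in>C. simple_perm b \<and> contained_in a b)"
  shows "\<not> deflatable C"
proof
  assume "deflatable C"
  then obtain D where D: "perm_class D" "D \<subset> C" "C \<subseteq> subst_closure D" unfolding deflatable_def by blast
  then obtain a where a: "a \<in> C" "a \<notin> D" by blast
  obtain b where b: "b \<in> C" "simple_perm b" "contained_in a b" using assms[OF a(1)] by blast
  then have "b \<in> simples (subst_closure D)" using D(3) unfolding simples_def by blast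
  then have "b \<in> D" using subst_closure_largest(2)[OF D(1)] unfolding simples_def by blast
  then show False using D(1) assms[OF a(1)] b(3) a(2) unfolding perm_class_def by blast
qed

context pattern
begin

lemma simple_extension:
  assumes "a \<in> Av p"
  obtains b where "b \<in> Av p" "simple_perm b" "contained_in a b"
proof -
  have a: "is_perm a" "\<not> contained_in p a" using assms unfolding Av_def by auto
  obtain P g where P: "generic P" "represents a P g" using perm_representable[OF a(1)] by blast
  have avP: "avoids p P" using a(2) contained_in_iff_occurrence[OF P(2)] unfolding avoids_def by blast
  have occ: "occurrence a P g"
    using P(2) unfolding represents_def occurrence_def bij_betw_def by auto
  \<comment> \<open>The empty permutation has an empty drawing, which is replaced by a single point
    so that \<open>extend_simple\<close> applies; a pattern with at least four entries does not fit
    into it.\<close>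
  have "\<exists>P'. generic P' \<and> avoids p P' \<and> P' \<noteq> {} \<and> occurrence a P' g"
  proof (cases "P = {}")
    case True
    have "generic {(0, 0)}" unfolding generic_def by simp
    moreover have "avoids p {(0, 0)}" unfolding avoids_def
    proof (intro allI notI)
      fix f assume f: "occurrence p {(0, 0)} f"
      then have "f 0 = f 1" using occurrenceD(1)[OF f, of 0] occurrenceD(1)[OF f, of 1] length_ge length_pos by auto
      then show False using occurrence_inj[OF f length_pos, of 1] length_ge by auto
    qed
    moreover have "occurrence a {(0, 0)} g" using occurrence_mono[OF occ] True by blast
    ultimately show ?thesis by blast
  qed (use P avP occ in blast)
  then obtain P' where P': "generic P'" "avoids p P'" "P' \<noteq> {}" "occurrence a P' g" by blast
  obtain Q where Q: "P' \<subseteq> Q" "generic Q" "avoids p Q" "intervals Q = {}"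
    using extend_simple[OF P'(1-3)] by blast
  obtain b f where b: "is_perm b" "represents b Q f" using generic_represented[OF Q(2)] by blast
  have "simple_perm b" using simple_perm_if_no_intervals[OF Q(2) b _ Q(4)] Q(1) P'(3) by blast
  moreover have "b \<in> Av p"
    using b Q(3) contained_in_iff_occurrence[OF b(2)] unfolding Av_def avoids_def by blast
  moreover have "contained_in a b"
    using contained_in_iff_occurrence[OF b(2)] occurrence_mono[OF P'(4) Q(1)] by blast
  ultimately show ?thesis using that by blast
qed

end

theorem theorem3p4:
  fixes \<pi> \<rho> :: "nat list"
  assumes "is_perm \<rho>"
    and "\<pi> = one_oplus \<rho>"
    and "length \<rho> \<ge> 2" and "\<rho> ! 0 > \<rho> ! 1"
    and "\<not> has_increasing_bond \<pi>"
    and "ddagger \<pi>"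
  shows "\<not> deflatable (Av \<pi>)"
proof -
  have \<rho>: "set \<rho> = {1..length \<rho>}" "distinct \<rho>"
    using assms(1) permutations_of_setD[of \<rho>] unfolding is_perm_def by blast+
  have "set \<pi> = insert 1 (Suc ` {1..length \<rho>})" using assms(2) \<rho>(1) unfolding one_oplus_def by simp
  also have "\<dots> = {1..length \<pi>}"
    using assms(2) unfolding one_oplus_def image_Suc_atLeastAtMost by auto
  finally have "set \<pi> = {1..length \<pi>}" .
  moreover have "distinct \<pi>"
    using assms(2) \<rho> unfolding one_oplus_def by (auto simp: distinct_map)
  ultimately have "is_perm \<pi>" unfolding is_perm_def by blast
  then interpret pattern \<pi>
    using assms(2,5,6) by unfold_locales (auto simp: one_oplus_def)
  show ?thesis
    by (rule not_deflatable_if_simple_extensions) (use simple_extension in \<open>auto simp: Av_def\<close>)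
qed

end
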